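(* Let $n \geq 2$. There exist germs $\varphi_{1},\varphi_{2} \in \mathrm{Diff}(\mathbb{C}^{n},0)$ such that $\hat{\sigma} \circ \varphi_{1} = \varphi_{2} \circ \hat{\sigma}$ for some $\hat{\sigma} \in \widehat{\mathrm{Diff}}(\mathbb{C}^{n},0)$, but no $\hat{\sigma} \in \widehat{\mathrm{Diff}}(\mathbb{C}^{n},0)$ with $\hat{\sigma} \circ \varphi_{1} = \varphi_{2} \circ \hat{\sigma}$ is transversally formal along the fixed points set $\mathrm{Fix}(\varphi_{1})$.
   Context: $\mathrm{Diff}(\mathbb{C}^{n},0)$ is the group of germs at $0$ of complex analytic diffeomorphisms of $\mathbb{C}^n$ fixing $0$. $\widehat{\mathrm{Diff}}(\mathbb{C}^{n},0)$ is its formal completion: the group (under formal composition) of $n$-tuples of power series in $\mathbb{C}[[y_1,\ldots,y_n]]$ with zero constant terms and invertible linear part. $\mathrm{Fix}(\varphi)$ is the germ at $0$ of the analytic set of fixed points of $\varphi$. Let $\gamma$ be a germ of analytic set at $0\in\mathbb{C}^n$ with ideal $I(\gamma)\subset \mathbb{C}\{y_1,\ldots,y_n\}$ (the germs of holomorphic functions vanishing on $\gamma$). An element $\hat{\sigma} \in \widehat{\mathrm{Diff}}(\mathbb{C}^{n},0)$ is transversally formal along $\gamma$ if, for every $1\le j\le n$, the component $y_j\circ\hat{\sigma}$ can be written as $\sum_{k=0}^{\infty} c_{j,k}$ (convergence in the Krull topology) with $c_{j,k}\in \mathbb{C}\{y_1,\ldots,y_n\}\cap I(\gamma)^k$ for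 all $k\ge 0$. *)

theory Defs
  imports "HOL-Analysis.Analysis"
begin

section \<open>Formal power series in finitely many variables\<close>

text \<open>
  Exponents are vectors of type \<^typ>\<open>nat^'n\<close>; the variables are indexed by the finite type
  \<open>'n\<close>, so that \<open>CARD('n)\<close> is their number.
\<close>

typedef ('a, 'n) mfps = "UNIV :: (nat^'n \<Rightarrow> 'a) set"
  morphisms mfps_nth Abs_mfps ..

lemma mfps_nth_Abs [simp]: "mfps_nth (Abs_mfps f) = f"
  by (simp add: Abs_mfps_inverse)

lemma mfps_eqI: "(\<And>m. mfps_nth F m = mfps_nth G m) \<Longrightarrow> F = G"
  by (metis ext mfps_nth_inject)

lemma finite_exponents_le: "finite {a :: nat^'n::finite. \<forall>i. a $ i \<le> m $ i}"
proof -
  have "finite (PiE (UNIV :: 'n set) (\<lambda>i. {..m $ i}))"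
    by (rule finite_PiE) auto
  moreover have "{a :: nat^'n. \<forall>i. a $ i \<le> m $ i} \<subseteq> vec_lambda ` PiE UNIV (\<lambda>i. {..m $ i})"
  proof
    fix a :: "nat^'n" assume "a \<in> {a. \<forall>i. a $ i \<le> m $ i}"
    then have "vec_nth a \<in> PiE UNIV (\<lambda>i. {..m $ i})" by (auto simp: PiE_def)
    then show "a \<in> vec_lambda ` PiE UNIV (\<lambda>i. {..m $ i})"
      by (metis image_eqI vec_nth_inverse)
  qed
  ultimately show ?thesis by (meson finite_surj)
qed

lemma finite_exponents_add: "finite {(a, b). a + b = (m :: nat^'n::finite)}"
proof -
  have "{(a, b). a + b = m} \<subseteq> {a. \<forall>i. a $ i \<le> m $ i} \<times> {a. \<forall>i. a $ i \<le> m $ i}"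
    by auto
  then show ?thesis
    by (rule finite_subset) (intro finite_cartesian_product finite_exponents_le)
qed

instantiation mfps :: (comm_ring_1, finite) comm_ring_1
begin

definition "0 = Abs_mfps (\<lambda>_. 0)"
definition "1 = Abs_mfps (\<lambda>m. if m = 0 then 1 else 0)"
definition "F + G = Abs_mfps (\<lambda>m. mfps_nth F m + mfps_nth G m)"
definition "- F = Abs_mfps (\<lambda>m. - mfps_nth F m)"
definition "F - G = Abs_mfps (\<lambda>m. mfps_nth F m - mfps_nth G m)"
definition "F * G = Abs_mfps (\<lambda>m. \<Sum>(a, b) | a + b = m. mfps_nth F a * mfps_nth G b)"

instance
proof
  fix F G H :: "('a, 'b) mfps"
  show "F * G * H = F * (G * H)"
  proof (rule mfps_eqI)
    fix m :: "nat^'b"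
    let ?P = "\<lambda>m :: nat^'b. {(a, b). a + b = m}"
    let ?f = "mfps_nth F" and ?g = "mfps_nth G" and ?h = "mfps_nth H"
    have "mfps_nth (F * G * H) m
        = (\<Sum>x\<in>?P m. \<Sum>y\<in>?P (fst x). ?f (fst y) * ?g (snd y) * ?h (snd x))"
      by (simp add: times_mfps_def sum_distrib_right case_prod_unfold)
    also have "\<dots> = (\<Sum>(x, y)\<in>Sigma (?P m) (\<lambda>x. ?P (fst x)). ?f (fst y) * ?g (snd y) * ?h (snd x))"
      by (rule sum.Sigma) (auto simp: finite_exponents_add)
    also have "\<dots> = (\<Sum>(x, y)\<in>Sigma (?P m) (\<lambda>x. ?P (snd x)). ?f (fst x) * (?g (fst y) * ?h (snd y)))"
      by (rule sum.reindex_bij_witness[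
            where i = "\<lambda>(x, y). ((fst x + fst y, snd y), (fst x, fst y))"
              and j = "\<lambda>(x, y). ((fst y, snd y + snd x), (snd y, snd x))"])
         (auto simp: add.assoc mult.assoc)
    also have "\<dots> = (\<Sum>x\<in>?P m. \<Sum>y\<in>?P (snd x). ?f (fst x) * (?g (fst y) * ?h (snd y)))"
      by (rule sum.Sigma[symmetric]) (auto simp: finite_exponents_add)
    also have "\<dots> = mfps_nth (F * (G * H)) m"
      by (simp add: times_mfps_def sum_distrib_left case_prod_unfold)
    finally show "mfps_nth (F * G * H) m = mfps_nth (F * (G * H)) m" .
  qed
  show "F * G = G * F"
    unfolding times_mfps_def
    by (intro arg_cong[where f = Abs_mfps] ext sum.reindex_bij_witness[where i = prod.swap and j = prod.swap])
       (auto simp: add.commute mult.commute)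
  show "1 * F = F"
  proof (rule mfps_eqI)
    fix m :: "nat^'b"
    have "mfps_nth (1 * F) m
        = (\<Sum>x | fst x + snd x = m. if x = (0, m) then mfps_nth F m else 0)"
      by (auto simp: times_mfps_def one_mfps_def case_prod_unfold intro!: sum.cong)
    also have "\<dots> = mfps_nth F m"
      using finite_exponents_add[of m] by (subst sum.delta) (auto simp: case_prod_unfold)
    finally show "mfps_nth (1 * F) m = mfps_nth F m" .
  qed
  show "(F + G) * H = F * H + G * H"
    by (simp add: times_mfps_def plus_mfps_def case_prod_unfold distrib_right sum.distrib)
  show "(0 :: ('a, 'b) mfps) \<noteq> 1"
  proof
    assume "(0 :: ('a, 'b) mfps) = 1"
    then have "mfps_nth (0 :: ('a, 'b) mfps) 0 = mfps_nth 1 0" by simp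
    then show False by (simp add: zero_mfps_def one_mfps_def)
  qed
qed (rule mfps_eqI, simp add: plus_mfps_def zero_mfps_def uminus_mfps_def minus_mfps_def ac_simps)+

end

definition exponent_degree :: "nat^'n::finite \<Rightarrow> nat" where
  "exponent_degree m = (\<Sum>i\<in>UNIV. m $ i)"

lemma finite_exponent_degree_le: "finite {k :: nat^'n::finite. exponent_degree k \<le> d}"
proof (rule finite_subset)
  show "{k :: nat^'n. exponent_degree k \<le> d} \<subseteq> {k. \<forall>i. k $ i \<le> (\<chi> i. d) $ i}"
  proof (intro subsetI CollectI allI)
    fix k :: "nat^'n" and i assume "k \<in> {k. exponent_degree k \<le> d}"
    moreover have "k $ i \<le> (\<Sum>i\<in>UNIV. k $ i)" by (rule member_le_sum) auto
    ultimately show "k $ i \<le> (\<chi> i. d) $ i" by (simp add: exponent_degree_def)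
  qed
qed (rule finite_exponents_le)

text \<open>
  The substitution \<open>F(G\<^sub>1, \<dots>, G\<^sub>n)\<close>, meaningful when all \<open>G\<^sub>i\<close> have zero constant term.  The product
  \<open>G\<^sup>k\<close> then only has terms of degree at least \<open>|k|\<close>, so the truncation to
  \<open>|k| \<le> |m|\<close> omits only zero summands.
\<close>

definition mfps_compose :: "('a::comm_ring_1, 'n::finite) mfps \<Rightarrow> ('a, 'n) mfps ^ 'n \<Rightarrow> ('a, 'n) mfps" where
  "mfps_compose F G = Abs_mfps (\<lambda>m. \<Sum>k | exponent_degree k \<le> exponent_degree m.
     mfps_nth F k * mfps_nth (\<Prod>i\<in>UNIV. (G $ i) ^ (k $ i)) m)"

definition formal_comp :: "('a::comm_ring_1, 'n::finite) mfps ^ 'n \<Rightarrow> ('a, 'n) mfps ^ 'n \<Rightarrow> ('a, 'n) mfps ^ 'n" where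
  "formal_comp F G = (\<chi> j. mfps_compose (F $ j) G)"

definition formal_Diff :: "((complex, 'n::finite) mfps ^ 'n) set" where
  "formal_Diff = {\<sigma>. (\<forall>j. mfps_nth (\<sigma> $ j) 0 = 0) \<and>
     invertible (\<chi> j i. mfps_nth (\<sigma> $ j) (axis i 1) :: complex^'n^'n)}"


section \<open>Ideal powers and the Krull topology\<close>

text \<open>The powers of an ideal \<open>I\<close> of a subring \<open>R\<close>, with \<open>I\<^sup>0 = R\<close>.\<close>

primrec ideal_power :: "'a::comm_ring_1 set \<Rightarrow> 'a set \<Rightarrow> nat \<Rightarrow> 'a set" where
  "ideal_power R I 0 = R"
| "ideal_power R I (Suc k) =
     {(\<Sum>i<N. a i * b i) | (N::nat) a b. \<forall>i<N. a i \<in> I \<and> b i \<in> ideal_power R I k}"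

definition mfps_maximal_ideal :: "('a::comm_ring_1, 'n::finite) mfps set" where
  "mfps_maximal_ideal = {F. mfps_nth F 0 = 0}"

definition krull_sums :: "(nat \<Rightarrow> ('a::comm_ring_1, 'n::finite) mfps) \<Rightarrow> ('a, 'n) mfps \<Rightarrow> bool"
    (infixr \<open>krull'_sums\<close> 80) where
  "c krull_sums F \<longleftrightarrow>
     (\<forall>d. \<forall>\<^sub>F N in sequentially. F - (\<Sum>k<N. c k) \<in> ideal_power UNIV mfps_maximal_ideal d)"


section \<open>Analytic germs at the origin\<close>

text \<open>
  Germs at 0 of functions, maps and sets are given by representatives defined on the whole space;
  all notions below depend only on the restriction to arbitrarily small neighbourhoods of 0.
  The ring \<open>\<^bold>C{y\<^sub>1, \<dots>, y\<^sub>n}\<close> of holomorphic germs is identified with the ring of convergent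
  power series, and a germ of diffeomorphism fixing 0 is an analytic germ fixing 0 that has an
  analytic two-sided inverse germ fixing 0.
\<close>

definition has_mfps_expansion :: "(complex^'n::finite \<Rightarrow> complex) \<Rightarrow> (complex, 'n) mfps \<Rightarrow> bool"
    (infixl \<open>has'_mfps'_expansion\<close> 60) where
  "f has_mfps_expansion F \<longleftrightarrow>
     (\<forall>\<^sub>F z in nhds 0. ((\<lambda>m. mfps_nth F m * (\<Prod>i\<in>UNIV. (z $ i) ^ (m $ i))) has_sum f z) UNIV)"

definition has_taylor :: "(complex^'n::finite \<Rightarrow> complex^'n) \<Rightarrow> (complex, 'n) mfps ^ 'n \<Rightarrow> bool"
    (infixl \<open>has'_taylor\<close> 60) where
  "\<phi> has_taylor \<Phi> \<longleftrightarrow> (\<forall>j. (\<lambda>z. \<phi> z $ j) has_mfps_expansion (\<Phi> $ j))"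

definition analytic_Diff :: "(complex^'n::finite \<Rightarrow> complex^'n) set" where
  "analytic_Diff = {\<phi>. \<phi> 0 = 0 \<and> (\<exists>\<Phi>. \<phi> has_taylor \<Phi>) \<and>
     (\<exists>\<psi>. \<psi> 0 = 0 \<and> (\<exists>\<Psi>. \<psi> has_taylor \<Psi>) \<and>
       (\<forall>\<^sub>F z in nhds 0. \<psi> (\<phi> z) = z) \<and> (\<forall>\<^sub>F z in nhds 0. \<phi> (\<psi> z) = z))}"

definition Fix :: "(complex^'n::finite \<Rightarrow> complex^'n) \<Rightarrow> (complex^'n) set" where
  "Fix \<phi> = {z. \<phi> z = z}"

definition convergent_mfps :: "(complex, 'n::finite) mfps set" where
  "convergent_mfps = {F. \<exists>f. f has_mfps_expansion F}"

definition vanishing_ideal :: "(complex^'n::finite) set \<Rightarrow> (complex, 'n) mfps set" where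
  "vanishing_ideal \<gamma> =
     {F. \<exists>f. f has_mfps_expansion F \<and> (\<forall>\<^sub>F z in nhds 0. z \<in> \<gamma> \<longrightarrow> f z = 0)}"

definition transversally_formal :: "(complex, 'n::finite) mfps ^ 'n \<Rightarrow> (complex^'n) set \<Rightarrow> bool" where
  "transversally_formal \<sigma> \<gamma> \<longleftrightarrow>
     (\<forall>j. \<exists>c. (\<forall>k. c k \<in> ideal_power convergent_mfps (vanishing_ideal \<gamma>) k) \<and> c krull_sums (\<sigma> $ j))"

end

theory Submission
  imports Defs "HOL-Complex_Analysis.Complex_Analysis"
begin

text \<open>
  Put \<open>y' = y + y\<^sup>2\<close> and consider \<open>\<phi>\<^sub>1(x, y) = (x (1 + x y'), y')\<close> and \<open>\<phi>\<^sub>2(x, y) = (x / (1 - x y'), y')\<close>, acting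
  trivially on all other coordinates; both fix exactly \<open>{y = 0}\<close>.  In the coordinate \<open>u = 1 / x\<close> the map
  \<open>\<phi>\<^sub>2\<close> is the translation \<open>u \<mapsto> u - y'\<close>, so a conjugacy \<open>(x / (1 + x h), y)\<close> amounts to the linear
  equation \<open>h \<circ> \<phi>\<^sub>1 - h = p\<close> with \<open>p = - x y'\<^sup>2 / (1 + x y')\<close>, which is formally solvable since \<open>y\<^sup>2\<close>
  divides \<open>p\<close>.  To lowest order \<open>\<phi>\<^sub>1\<close> is the flow of \<open>y\<close> times the saddle-node \<open>x\<^sup>2 \<partial>\<^sub>x + y \<partial>\<^sub>y\<close>, whose
  central manifold is the fixed curve.  Expanding an arbitrary conjugacy in powers of \<open>y\<close> therefore
  leads to an Euler equation \<open>h + x\<^sup>2 h' = c + x\<close> for the coefficient of \<open>y\<close>; its only formal solution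
  diverges factorially, whereas transversal formality would make that coefficient convergent.
\<close>

text \<open>The difficulty is that every conjugacy has to be excluded, not only the one with
  components \<open>x / (1 + x h)\<close> and \<open>y\<close>. The equation is therefore expanded
  along the fixed set without normalising \<open>\<sigma>\<close>. Write \<open>v0, v1, ...\<close>
  and \<open>s0, s1, ...\<close> for the coefficients of the powers of y in the components of
  \<open>\<sigma>\<close> with index y and x, restricted to the (x, y) plane. They are forced one
  after another: \<open>v0 = 0\<close>, \<open>v1 = 1\<close>, \<open>v2\<close> is a constant,
  \<open>x^2 s0' = s0^2\<close>, and \<open>s1 = s0^2 h\<close> with h a solution of Euler's
  equation. The remaining freedom enters Euler's equation only through c, while the term x on its
  right is rigid and drives the factorial growth. Formal solvability and divergence have one source:
  \<open>x^2 d/dx\<close> raises the order in x, so \<open>1 + x^2 d/dx\<close> is invertible on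
  formal series but not on convergent ones. Invertibility of the linear part of
  \<open>\<sigma>\<close>, which involves all n coordinates, guarantees that \<open>s0\<close> has
  order one, so that h can be recovered from \<open>s1\<close>.\<close>

no_notation fps_nth (infixl "$" 75)

section \<open>Coefficients and orders of formal power series\<close>

lemma mfps_nth_zero [simp]: "mfps_nth 0 m = 0"
  by (simp add: zero_mfps_def)

lemma mfps_nth_one: "mfps_nth 1 m = (if m = 0 then 1 else 0)"
  by (simp add: one_mfps_def)

lemma mfps_nth_add [simp]: "mfps_nth (F + G) m = mfps_nth F m + mfps_nth G m"
  by (simp add: plus_mfps_def)

lemma mfps_nth_diff [simp]: "mfps_nth (F - G) m = mfps_nth F m - mfps_nth G m"
  by (simp add: minus_mfps_def)

lemma mfps_nth_uminus [simp]: "mfps_nth (- F) m = - mfps_nth F m"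
  by (simp add: uminus_mfps_def)

lemma mfps_nth_mult:
  "mfps_nth (F * G) m = (\<Sum>(a, b) | a + b = m. mfps_nth F a * mfps_nth G b)"
  by (simp add: times_mfps_def)

lemma mfps_nth_sum: "mfps_nth (\<Sum>i\<in>A. F i) m = (\<Sum>i\<in>A. mfps_nth (F i) m)"
  by (induction A rule: infinite_finite_induct) auto

lemma exponent_degree_add [simp]:
  "exponent_degree (a + b) = exponent_degree a + exponent_degree b"
  by (simp add: exponent_degree_def sum.distrib)

lemma exponent_degree_zero [simp]: "exponent_degree 0 = 0"
  by (simp add: exponent_degree_def)

lemma exponent_degree_eq_0 [simp]: "exponent_degree m = 0 \<longleftrightarrow> m = 0"
  by (auto simp: exponent_degree_def vec_eq_iff)

lemma exponent_degree_axis [simp]: "exponent_degree (axis i n) = n"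
  by (simp add: exponent_degree_def axis_def)

lemma mfps_nth_mult_zero [simp]: "mfps_nth (F * G) 0 = mfps_nth F 0 * mfps_nth G 0"
proof -
  have "{(a, b). a + b = (0 :: nat^'b)} = {(0, 0)}"
    by (auto simp: vec_eq_iff)
  then show ?thesis by (simp add: mfps_nth_mult)
qed

definition mfps_order_ge :: "nat \<Rightarrow> ('a::comm_ring_1, 'n::finite) mfps \<Rightarrow> bool" where
  "mfps_order_ge d F \<longleftrightarrow> (\<forall>m. exponent_degree m < d \<longrightarrow> mfps_nth F m = 0)"

lemma mfps_order_ge_mult:
  assumes "mfps_order_ge d F" "mfps_order_ge e G"
  shows "mfps_order_ge (d + e) (F * G)"
  unfolding mfps_order_ge_def
proof (intro allI impI)
  fix m :: "nat^'b" assume m: "exponent_degree m < d + e"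
  show "mfps_nth (F * G) m = 0"
    unfolding mfps_nth_mult
  proof (rule sum.neutral, clarify)
    fix a b assume "m = a + b"
    with m have "exponent_degree a < d \<or> exponent_degree b < e" by auto
    with assms show "mfps_nth F a * mfps_nth G b = 0" by (auto simp: mfps_order_ge_def)
  qed
qed

lemma mfps_order_ge_0 [simp]: "mfps_order_ge 0 F"
  by (simp add: mfps_order_ge_def)

lemma mfps_order_ge_1 [simp]: "mfps_order_ge (Suc 0) F \<longleftrightarrow> mfps_nth F 0 = 0"
  by (simp add: mfps_order_ge_def)

lemma mfps_order_ge_power:
  "mfps_order_ge d F \<Longrightarrow> mfps_order_ge (k * d) (F ^ k)"
  by (induction k) (auto intro: mfps_order_ge_mult)

lemma mfps_order_ge_prod:
  "(\<And>i. i \<in> A \<Longrightarrow> mfps_order_ge (d i) (F i)) \<Longrightarrow> mfps_order_ge (\<Sum>i\<in>A. d i) (\<Prod>i\<in>A. F i)"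
  by (induction A rule: infinite_finite_induct) (auto intro: mfps_order_ge_mult)

text \<open>Turns Krull convergence into equality of coefficients: two series that differ by an
  element of the d-th power share every coefficient of total degree below d.\<close>

lemma ideal_power_maximal_order:
  "F \<in> ideal_power UNIV mfps_maximal_ideal d \<Longrightarrow> mfps_order_ge d F"
proof (induction d arbitrary: F)
  case (Suc d)
  then obtain N a b where F: "F = (\<Sum>i<(N::nat). a i * b i)"
    and ab: "\<And>i. i < N \<Longrightarrow> mfps_nth (a i) 0 = 0 \<and> mfps_order_ge d (b i)"
    by (auto simp: mfps_maximal_ideal_def)
  have "mfps_order_ge (Suc 0 + d) (a i * b i)" if "i < N" for i
    using ab[OF that] by (intro mfps_order_ge_mult) auto
  then show ?case
    by (auto simp: F mfps_order_ge_def mfps_nth_sum intro!: sum.neutral)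
qed simp


section \<open>Monomials\<close>

definition mfps_monom :: "nat^'n \<Rightarrow> ('a::comm_ring_1, 'n::finite) mfps" where
  "mfps_monom k = Abs_mfps (\<lambda>m. if m = k then 1 else 0)"

definition mfps_X :: "'n \<Rightarrow> ('a::comm_ring_1, 'n::finite) mfps" where
  "mfps_X i = mfps_monom (axis i 1)"

lemma mfps_nth_monom: "mfps_nth (mfps_monom k) m = (if m = k then 1 else 0)"
  by (simp add: mfps_monom_def)

lemma mfps_nth_monom_mult_add: "mfps_nth (mfps_monom k * F) (k + m) = mfps_nth F m"
proof -
  have "mfps_nth (mfps_monom k * F) (k + m)
      = (\<Sum>x | fst x + snd x = k + m. if x = (k, m) then mfps_nth F m else 0)"
    by (auto simp: mfps_nth_mult mfps_nth_monom case_prod_unfold intro!: sum.cong)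
  also have "\<dots> = mfps_nth F m"
    using finite_exponents_add[of "k + m"] by (subst sum.delta) (auto simp: case_prod_unfold)
  finally show ?thesis .
qed

lemma mfps_nth_monom_mult_eq_0:
  assumes "m $ i < k $ i"
  shows "mfps_nth (mfps_monom k * F) m = 0"
  using assms by (auto simp: mfps_nth_mult mfps_nth_monom intro!: sum.neutral)

lemma mfps_nth_monom_mult:
  "mfps_nth (mfps_monom k * F) m = (if \<forall>i. k $ i \<le> m $ i then mfps_nth F (m - k) else 0)"
proof (cases "\<forall>i. k $ i \<le> m $ i")
  case True
  then have "m = k + (m - k)" by (auto simp: vec_eq_iff)
  with True show ?thesis by (metis mfps_nth_monom_mult_add)
next
  case False
  then obtain i where "m $ i < k $ i" by (auto simp: not_le)
  with False show ?thesis by (simp only: mfps_nth_monom_mult_eq_0 if_False)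
qed

lemma mfps_monom_mult: "mfps_monom a * mfps_monom b = mfps_monom (a + b)"
proof (rule mfps_eqI)
  fix m
  have "m - a = b \<and> (\<forall>i. a $ i \<le> m $ i) \<longleftrightarrow> m = a + b"
    by (simp add: vec_eq_iff) (metis diff_add_inverse le_add1 le_add_diff_inverse)
  then show "mfps_nth (mfps_monom a * mfps_monom b) m = mfps_nth (mfps_monom (a + b)) m"
    by (auto simp: mfps_nth_monom_mult mfps_nth_monom)
qed

lemma mfps_monom_0: "mfps_monom 0 = 1"
  by (rule mfps_eqI) (simp add: mfps_nth_monom mfps_nth_one)

lemma axis_zero [simp]: "axis i 0 = (0 :: 'a::zero^'n)"
  by (simp add: vec_eq_iff axis_def)

lemma axis_add: "axis i a + axis i b = (axis i (a + b) :: 'a::monoid_add^'n)"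
  by (simp add: vec_eq_iff axis_def)

lemma mfps_X_power: "mfps_X i ^ k = mfps_monom (axis i k)"
  by (induction k) (simp_all add: mfps_monom_0 mfps_X_def mfps_monom_mult axis_add)

lemma prod_mfps_X_power:
  "(\<Prod>i\<in>UNIV. mfps_X i ^ (k $ i)) = (mfps_monom k :: ('a::comm_ring_1, 'n::finite) mfps)"
proof -
  have *: "(\<Prod>i\<in>A. mfps_X i ^ (k $ i))
      = (mfps_monom (\<Sum>i\<in>A. axis i (k $ i)) :: ('a, 'n) mfps)" for A :: "'n set"
    by (induction A rule: infinite_finite_induct)
       (auto simp: mfps_monom_0 mfps_monom_mult mfps_X_power)
  have "(\<Sum>i\<in>UNIV. axis i (k $ i)) = k"
    by (auto simp: vec_eq_iff axis_def)
  with * show ?thesis by metis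
qed

lemma mfps_nth_X_0 [simp]: "mfps_nth (mfps_X i) 0 = 0"
  by (auto simp: mfps_X_def mfps_nth_monom vec_eq_iff axis_def)


section \<open>Substitution\<close>

definition mfps_prod_power :: "('a::comm_ring_1, 'n::finite) mfps ^ 'n \<Rightarrow> nat^'n \<Rightarrow> ('a, 'n) mfps" where
  "mfps_prod_power G k = (\<Prod>i\<in>UNIV. (G $ i) ^ (k $ i))"

lemma mfps_prod_power_add: "mfps_prod_power G (a + b) = mfps_prod_power G a * mfps_prod_power G b"
  by (simp add: mfps_prod_power_def power_add prod.distrib)

lemma mfps_prod_power_axis: "mfps_prod_power G (axis i 1) = G $ i"
proof -
  have "mfps_prod_power G (axis i 1) = (\<Prod>j\<in>UNIV. if j = i then G $ i else 1)"
    unfolding mfps_prod_power_def by (rule prod.cong) (auto simp: axis_def)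
  also have "\<dots> = G $ i" by simp
  finally show ?thesis .
qed

lemma mfps_prod_power_order:
  assumes "\<And>i. mfps_nth (G $ i) 0 = 0"
  shows "mfps_order_ge (exponent_degree k) (mfps_prod_power G k)"
  unfolding mfps_prod_power_def exponent_degree_def
proof (rule mfps_order_ge_prod)
  fix i show "mfps_order_ge (k $ i) (G $ i ^ k $ i)"
    using mfps_order_ge_power[of 1 "G $ i" "k $ i"] assms by simp
qed

lemma mfps_nth_compose:
  "mfps_nth (mfps_compose F G) m = (\<Sum>k | exponent_degree k \<le> exponent_degree m.
     mfps_nth F k * mfps_nth (mfps_prod_power G k) m)"
  by (simp add: mfps_compose_def mfps_prod_power_def)

text \<open>Since \<open>G\<close> has no constant term, \<open>k\<close> of degree above that of
  \<open>m\<close> contributes 0. One bound \<open>d\<close> can therefore serve several exponents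
  at once, as the product rule for substitution requires.\<close>

lemma mfps_nth_compose_ge:
  assumes "\<And>i. mfps_nth (G $ i) 0 = 0" "exponent_degree m \<le> d"
  shows "mfps_nth (mfps_compose F G) m = (\<Sum>k | exponent_degree k \<le> d.
     mfps_nth F k * mfps_nth (mfps_prod_power G k) m)"
  unfolding mfps_nth_compose
proof (rule sum.mono_neutral_left)
  show "\<forall>i\<in>{k. exponent_degree k \<le> d} - {k. exponent_degree k \<le> exponent_degree m}.
       mfps_nth F i * mfps_nth (mfps_prod_power G i) m = 0"
    using mfps_prod_power_order[of G, OF assms(1)] by (auto simp: mfps_order_ge_def not_le)
qed (use assms finite_exponent_degree_le in auto)

lemma mfps_compose_add: "mfps_compose (F + H) G = mfps_compose F G + mfps_compose H G"
  by (rule mfps_eqI) (simp add: mfps_nth_compose distrib_right sum.distrib)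

lemma mfps_compose_diff: "mfps_compose (F - H) G = mfps_compose F G - mfps_compose H G"
  by (rule mfps_eqI) (simp add: mfps_nth_compose left_diff_distrib sum_subtractf)

lemma mfps_compose_monom:
  assumes "\<And>i. mfps_nth (G $ i) 0 = 0"
  shows "mfps_compose (mfps_monom k) G = mfps_prod_power G k"
proof (rule mfps_eqI)
  fix m
  have "mfps_nth (mfps_compose (mfps_monom k) G) m
      = (\<Sum>j | exponent_degree j \<le> max (exponent_degree m) (exponent_degree k).
          if j = k then mfps_nth (mfps_prod_power G k) m else 0)"
    by (subst mfps_nth_compose_ge[OF assms, where d = "max (exponent_degree m) (exponent_degree k)"])
       (auto simp: mfps_nth_monom intro!: sum.cong)
  then show "mfps_nth (mfps_compose (mfps_monom k) G) m = mfps_nth (mfps_prod_power G k) m"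
    by (simp add: finite_exponent_degree_le)
qed

lemma mfps_compose_X:
  assumes "\<And>i. mfps_nth (G $ i) 0 = 0"
  shows "mfps_compose (mfps_X i) G = G $ i"
  unfolding mfps_X_def using assms by (simp only: mfps_compose_monom mfps_prod_power_axis)

lemma mfps_compose_1:
  assumes "\<And>i. mfps_nth (G $ i) 0 = 0"
  shows "mfps_compose 1 G = 1"
  using mfps_compose_monom[OF assms, of 0]
  by (simp add: mfps_monom_0 mfps_prod_power_def)

lemma mfps_compose_mult:
  fixes F H :: "('a::comm_ring_1, 'n::finite) mfps"
  assumes G: "\<And>i. mfps_nth (G $ i) 0 = 0"
  shows "mfps_compose (F * H) G = mfps_compose F G * mfps_compose H G"
proof (rule mfps_eqI)
  fix m :: "nat^'n"
  define d where "d = exponent_degree m"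
  let ?D = "{k :: nat^'n. exponent_degree k \<le> d}"
  let ?P = "\<lambda>k. mfps_prod_power G k"
  have fin: "finite ?D" by (rule finite_exponent_degree_le)
  have "mfps_nth (mfps_compose (F * H) G) m
      = (\<Sum>k\<in>?D. \<Sum>(a, b) | a + b = k. mfps_nth F a * mfps_nth H b * mfps_nth (?P (a + b)) m)"
    unfolding mfps_nth_compose mfps_nth_mult d_def
    by (intro sum.cong refl) (auto simp: sum_distrib_right intro!: sum.cong)
  also have "\<dots> = (\<Sum>(k, a, b)\<in>Sigma ?D (\<lambda>k. {(a, b). a + b = k}).
        mfps_nth F a * mfps_nth H b * mfps_nth (?P (a + b)) m)"
    by (rule sum.Sigma[OF fin]) (auto simp: finite_exponents_add)
  also have "\<dots> = (\<Sum>(a, b) | exponent_degree (a + b) \<le> d.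
        mfps_nth F a * mfps_nth H b * mfps_nth (?P (a + b)) m)"
    by (rule sum.reindex_bij_witness[where i = "\<lambda>(a, b). (a + b, a, b)" and j = snd]) auto
  \<comment> \<open>The triangle of pairs is enlarged to a square so that the sum factors. The added
    pairs have a power of \<open>G\<close> of order above the degree of \<open>m\<close>.\<close>
  also have "\<dots> = (\<Sum>(a, b)\<in>?D \<times> ?D. mfps_nth F a * mfps_nth H b * mfps_nth (?P (a + b)) m)"
  proof (rule sum.mono_neutral_left)
    have "mfps_nth (?P k) m = 0" if "\<not> exponent_degree k \<le> d" for k
      using mfps_prod_power_order[of G, OF G] that by (simp add: mfps_order_ge_def d_def)
    then show "\<forall>i\<in>?D \<times> ?D - {(a, b). exponent_degree (a + b) \<le> d}.
        (case i of (a, b) \<Rightarrow> mfps_nth F a * mfps_nth H b * mfps_nth (?P (a + b)) m) = 0"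
      by (metis (mono_tags, lifting) DiffD2 case_prodI mem_Collect_eq mult_zero_right surj_pair
          case_prod_conv)
  qed (use fin in auto)
  also have "\<dots> = (\<Sum>(a, b)\<in>?D \<times> ?D. \<Sum>(p, q) | p + q = m.
      (mfps_nth F a * mfps_nth (?P a) p) * (mfps_nth H b * mfps_nth (?P b) q))"
    by (intro sum.cong refl)
       (auto simp: mfps_prod_power_add mfps_nth_mult sum_distrib_left mult_ac intro!: sum.cong)
  also have "\<dots> = (\<Sum>(p, q) | p + q = m. \<Sum>(a, b)\<in>?D \<times> ?D.
      (mfps_nth F a * mfps_nth (?P a) p) * (mfps_nth H b * mfps_nth (?P b) q))"
    unfolding case_prod_unfold by (rule sum.swap)
  also have "\<dots> = (\<Sum>(p, q) | p + q = m. mfps_nth (mfps_compose F G) p * mfps_nth (mfps_compose H G) q)"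
  proof (intro sum.cong refl, clarify)
    fix p q :: "nat^'n" assume "m = p + q"
    then have "exponent_degree p \<le> d" "exponent_degree q \<le> d" by (auto simp: d_def)
    then show "(\<Sum>(a, b)\<in>?D \<times> ?D.
        (mfps_nth F a * mfps_nth (?P a) p) * (mfps_nth H b * mfps_nth (?P b) q))
      = mfps_nth (mfps_compose F G) p * mfps_nth (mfps_compose H G) q"
      by (simp add: mfps_nth_compose_ge[OF G] sum_product sum.cartesian_product)
  qed
  also have "\<dots> = mfps_nth (mfps_compose F G * mfps_compose H G) m"
    by (simp add: mfps_nth_mult)
  finally show "mfps_nth (mfps_compose (F * H) G) m
      = mfps_nth (mfps_compose F G * mfps_compose H G) m" .
qed


section \<open>Recursion on the degree\<close>

text \<open>Well-founded recursion on the total degree: the hypothesis says that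
  \<open>\<Theta> f k\<close> reads \<open>f\<close> only at exponents of smaller degree. It solves
  linear systems for unknown coefficients, here for inverses and for the difference
  equation.\<close>

lemma exponent_degree_recursion:
  fixes \<Theta> :: "(nat^'n::finite \<Rightarrow> 'a) \<Rightarrow> nat^'n \<Rightarrow> 'a"
  assumes "\<And>f g k. (\<And>j. exponent_degree j < exponent_degree k \<Longrightarrow> f j = g j) \<Longrightarrow> \<Theta> f k = \<Theta> g k"
  shows "\<exists>f. \<forall>k. f k = \<Theta> f k"
proof -
  let ?R = "inv_image less_than exponent_degree :: ((nat^'n) \<times> (nat^'n)) set"
  have "adm_wf ?R \<Theta>"
    unfolding adm_wf_def
  proof (intro allI impI)
    fix f g :: "nat^'n \<Rightarrow> 'a" and k :: "nat^'n"
    assume "\<forall>z. (z, k) \<in> ?R \<longrightarrow> f z = g z"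
    then show "\<Theta> f k = \<Theta> g k" by (intro assms) simp
  qed
  then have "wfrec ?R \<Theta> = \<Theta> (wfrec ?R \<Theta>)"
    by (intro wfrec_fixpoint wf_inv_image wf_less_than)
  then have "\<forall>k. wfrec ?R \<Theta> k = \<Theta> (wfrec ?R \<Theta>) k"
    by (intro allI) (rule fun_cong)
  then show ?thesis by (rule exI[of "\<lambda>f. \<forall>k. f k = \<Theta> f k"])
qed

lemma mfps_nth_mult_split:
  fixes F G :: "('a::comm_ring_1, 'n::finite) mfps"
  shows
  "mfps_nth (F * G) m = mfps_nth F 0 * mfps_nth G m
     + (\<Sum>(a, b) | a + b = m \<and> a \<noteq> 0. mfps_nth F a * mfps_nth G b)"
proof -
  have "{(a, b). a + b = m} = insert (0, m) {(a, b). a + b = m \<and> a \<noteq> 0}"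
    by auto
  moreover have "finite {(a, b). a + b = m \<and> a \<noteq> 0}"
    by (rule finite_subset[OF _ finite_exponents_add[of m]]) auto
  ultimately show ?thesis by (simp add: mfps_nth_mult)
qed

lemma mfps_right_inverse:
  fixes F :: "('a::comm_ring_1, 'n::finite) mfps"
  assumes "mfps_nth F 0 = 1"
  shows "\<exists>U. F * U = 1 \<and> mfps_nth U 0 = 1"
proof -
  have "\<exists>f. \<forall>k. f k = (if k = 0 then 1 else 0)
      - (\<Sum>(a, b) | a + b = (k :: nat^'n) \<and> a \<noteq> 0. mfps_nth F a * f b)"
  proof (rule exponent_degree_recursion)
    fix f g :: "nat^'n \<Rightarrow> 'a" and k :: "nat^'n"
    assume "\<And>j. exponent_degree j < exponent_degree k \<Longrightarrow> f j = g j"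
    then show "(if k = 0 then 1 else 0) - (\<Sum>(a, b) | a + b = (k :: nat^'n) \<and> a \<noteq> 0. mfps_nth F a * f b)
        = (if k = 0 then 1 else 0) - (\<Sum>(a, b) | a + b = (k :: nat^'n) \<and> a \<noteq> 0. mfps_nth F a * g b)"
      by (intro arg_cong2[where f = "(-)"] refl sum.cong)
         (auto simp: zero_less_iff_neq_zero)
  qed
  then obtain f where f: "\<And>k. f k = (if k = 0 then 1 else 0)
      - (\<Sum>(a, b) | a + b = (k :: nat^'n) \<and> a \<noteq> 0. mfps_nth F a * f b)" by blast
  have "F * Abs_mfps f = 1"
  proof (rule mfps_eqI)
    fix m show "mfps_nth (F * Abs_mfps f) m = mfps_nth 1 m"
      by (simp add: mfps_nth_mult_split assms mfps_nth_one f[of m])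
  qed
  moreover from this have "mfps_nth (F * Abs_mfps f) 0 = 1" by (simp add: mfps_nth_one)
  then have "mfps_nth (Abs_mfps f) 0 = 1" by (simp add: assms)
  ultimately show ?thesis by blast
qed

text \<open>Cancellation goes through an inverse, since over a general \<open>comm_ring_1\<close>
  the series ring may have zero divisors.\<close>

lemma mfps_mult_unit_cancel:
  assumes "mfps_nth F 0 = 1" "F * A = F * B"
  shows "A = B"
proof -
  obtain U where U: "F * U = 1" using mfps_right_inverse[OF assms(1)] by blast
  have "C = U * (F * C)" for C
  proof -
    have "U * (F * C) = (F * U) * C" by (simp only: mult_ac)
    then show ?thesis by (simp add: U)
  qed
  from this[of A] this[of B] assms(2) show ?thesis by simp
qed


section \<open>The formal conjugacy\<close>

text \<open>This is the y' of the overview.\<close>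

definition shifted_var :: "'n \<Rightarrow> ('a::comm_ring_1, 'n::finite) mfps" where
  "shifted_var y = mfps_X y * (1 + mfps_X y)"

definition shear_mfps :: "'n \<Rightarrow> 'n \<Rightarrow> ('a::comm_ring_1, 'n::finite) mfps ^ 'n" where
  "shear_mfps x y = (\<chi> i. if i = x then mfps_X x * (1 + mfps_X x * shifted_var y)
     else if i = y then shifted_var y else mfps_X i)"

lemma shifted_var_0 [simp]: "mfps_nth (shifted_var y) 0 = 0"
  by (simp add: shifted_var_def)

lemma shear_mfps_0 [simp]: "mfps_nth (shear_mfps x y $ i) 0 = 0"
  by (simp add: shear_mfps_def)

text \<open>Every component of the shear is its own variable times a unit, so a monomial is sent to
  itself times a unit.\<close>

lemma mfps_prod_power_shear:
  assumes "x \<noteq> y"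
  shows "mfps_prod_power (shear_mfps x y) k
    = mfps_monom k * ((1 + mfps_X x * shifted_var y) ^ (k $ x) * (1 + mfps_X y) ^ (k $ y))"
proof -
  let ?A = "(1 + mfps_X x * shifted_var y) ^ (k $ x)" and ?B = "(1 + mfps_X y) ^ (k $ y)"
  have "mfps_prod_power (shear_mfps x y) k
      = (\<Prod>i\<in>UNIV. mfps_X i ^ (k $ i) * ((if i = x then ?A else 1) * (if i = y then ?B else 1)))"
    unfolding mfps_prod_power_def using assms
    by (intro prod.cong) (auto simp: shear_mfps_def shifted_var_def power_mult_distrib)
  also have "\<dots> = mfps_monom k * (?A * ?B)"
    by (simp add: prod.distrib prod_mfps_X_power)
  finally show ?thesis .
qed

lemma power_one_plus_multiple:
  fixes P :: "('a::comm_ring_1, 'n::finite) mfps"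
  shows "\<exists>R. (1 + mfps_X y * P) ^ k = 1 + mfps_X y * R \<and> mfps_nth R 0 = of_nat k * mfps_nth P 0"
proof (induction k)
  case (Suc k)
  then obtain R where R: "(1 + mfps_X y * P) ^ k = 1 + mfps_X y * R"
    "mfps_nth R 0 = of_nat k * mfps_nth P 0" by blast
  then show ?case
    by (intro exI[of _ "P + R + mfps_X y * P * R"]) (auto simp: algebra_simps)
qed (auto intro!: exI[of _ 0])

text \<open>The factor \<open>(1 + y) ^ (k $ y)\<close> has first-order term \<open>k $ y\<close>
  times y. The factor coming from x changes by multiples of \<open>x y\<close> only, so
  \<open>k $ x\<close> is absent from the constant term of \<open>R\<close>.\<close>

lemma mfps_prod_power_shear_remainder:
  fixes k :: "nat^'n::finite"
  assumes "x \<noteq> y"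
  obtains R :: "('a::comm_ring_1, 'n) mfps" where "mfps_nth R 0 = of_nat (k $ y)"
    "mfps_prod_power (shear_mfps x y) k = mfps_monom k + mfps_monom (k + axis y 1) * R"
proof -
  obtain P :: "('a, 'n) mfps" where P: "(1 + mfps_X y * (mfps_X x * (1 + mfps_X y))) ^ (k $ x) = 1 + mfps_X y * P"
    "mfps_nth P 0 = 0"
    using power_one_plus_multiple[of y "mfps_X x * (1 + mfps_X y)" "k $ x"] by auto
  obtain Q :: "('a, 'n) mfps" where Q: "(1 + mfps_X y) ^ (k $ y) = 1 + mfps_X y * Q" "mfps_nth Q 0 = of_nat (k $ y)"
    using power_one_plus_multiple[of y 1 "k $ y"] by (auto simp: mfps_nth_one)
  have "mfps_prod_power (shear_mfps x y) k
      = mfps_monom k + mfps_monom (k + axis y 1) * (P + Q + mfps_X y * P * Q)"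
    using P(1) Q(1) by (simp add: mfps_prod_power_shear[OF assms] shifted_var_def
        mfps_X_def algebra_simps flip: mfps_monom_mult)
  then show ?thesis by (intro that[of "P + Q + mfps_X y * P * Q"]) (simp_all add: P Q)
qed

lemma mfps_nth_prod_power_shear_y_le:
  fixes k m :: "nat^'n::finite"
  assumes "x \<noteq> y" "m $ y \<le> k $ y"
  shows "mfps_nth (mfps_prod_power (shear_mfps x y) k :: ('a::comm_ring_1, 'n) mfps) m = (if m = k then 1 else 0)"
proof -
  obtain R :: "('a, 'n) mfps" where "mfps_prod_power (shear_mfps x y) k = mfps_monom k + mfps_monom (k + axis y 1) * R"
    using mfps_prod_power_shear_remainder[OF assms(1)] by blast
  moreover have "mfps_nth (mfps_monom (k + axis y 1) * R) m = 0"
    using assms(2) by (intro mfps_nth_monom_mult_eq_0[of _ y]) (simp add: axis_def)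
  ultimately show ?thesis by (simp add: mfps_nth_monom)
qed

lemma mfps_nth_prod_power_shear_low_degree:
  fixes k m :: "nat^'n::finite"
  assumes "x \<noteq> y" "exponent_degree m \<le> exponent_degree k + 1"
  shows "mfps_nth (mfps_prod_power (shear_mfps x y) k :: ('a::comm_ring_1, 'n) mfps) m
    = (if m = k then 1 else 0) + (if m = k + axis y 1 then of_nat (k $ y) else 0)"
proof -
  obtain R :: "('a, 'n) mfps" where R: "mfps_nth R 0 = of_nat (k $ y)"
    "mfps_prod_power (shear_mfps x y) k = mfps_monom k + mfps_monom (k + axis y 1) * R"
    using mfps_prod_power_shear_remainder[OF assms(1)] by metis
  have "mfps_nth (mfps_monom (k + axis y 1) * R) m = (if m = k + axis y 1 then of_nat (k $ y) else 0)"
  proof (cases "\<forall>i. (k + axis y 1) $ i \<le> m $ i")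
    case True
    then have m: "m = (k + axis y 1) + (m - (k + axis y 1))" by (auto simp: vec_eq_iff)
    then have "exponent_degree m = exponent_degree k + 1 + exponent_degree (m - (k + axis y 1))"
      by (metis exponent_degree_add exponent_degree_axis)
    with assms(2) have "m - (k + axis y 1) = 0" by simp
    with m have m': "m = k + axis y 1" by simp
    show ?thesis
      using mfps_nth_monom_mult_add[of "k + axis y 1" R 0] by (simp add: m' R(1))
  next
    case False
    then show ?thesis by (auto simp: mfps_nth_monom_mult)
  qed
  then show ?thesis by (simp add: R(2) mfps_nth_monom)
qed

text \<open>
  On a monomial divisible by \<open>y\<close> the operator \<open>h \<mapsto> h \<circ> \<Phi> - h\<close> is multiplication by a nonzero multiple
  of \<open>y\<close> up to terms of higher degree, so it can be inverted degree by degree.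
\<close>

lemma shear_difference_equation:
  fixes p :: "(complex, 'n::finite) mfps"
  assumes xy: "x \<noteq> y" and p: "\<And>m. m $ y < 2 \<Longrightarrow> mfps_nth p m = 0"
  obtains h where "mfps_compose h (shear_mfps x y) = h + p"
proof -
  let ?M = "\<lambda>k. mfps_nth (mfps_prod_power (shear_mfps x y) k :: (complex, 'n) mfps)"
  let ?e = "axis y 1 :: nat^'n"
  \<comment> \<open>Read the equation at \<open>k + ?e\<close>: besides a term that cancels against
    h, exponents of degree at least that of \<open>k\<close> contribute only \<open>k $ y\<close>
    times \<open>f k\<close>, so \<open>f k\<close> is determined by lower degrees. Where this
    factor is 0 the value 0 is chosen, which makes h divisible by y.\<close>
  have "\<exists>f. \<forall>k. f k = (if k $ y = 0 then 0 else
      (mfps_nth p (k + ?e) - (\<Sum>j | exponent_degree j < exponent_degree k. f j * ?M j (k + ?e)))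
        / of_nat (k $ y))"
    by (rule exponent_degree_recursion) simp
  then obtain f where f: "\<And>k. f k = (if k $ y = 0 then 0 else
      (mfps_nth p (k + ?e) - (\<Sum>j | exponent_degree j < exponent_degree k. f j * ?M j (k + ?e)))
        / of_nat (k $ y))" by blast
  have f0: "f k = 0" if "k $ y = 0" for k using that by (subst f) simp
  have "mfps_compose (Abs_mfps f) (shear_mfps x y) = Abs_mfps f + p"
  proof (rule mfps_eqI)
    fix m :: "nat^'n"
    let ?D = "\<lambda>d. {k :: nat^'n. exponent_degree k \<le> d}"
    have comp: "mfps_nth (mfps_compose (Abs_mfps f) (shear_mfps x y)) m
        = (\<Sum>k\<in>?D (exponent_degree m). f k * ?M k m)"
      by (simp add: mfps_nth_compose)
    show "mfps_nth (mfps_compose (Abs_mfps f) (shear_mfps x y)) m = mfps_nth (Abs_mfps f + p) m"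
    proof (cases "m $ y < 2")
      case True
      \<comment> \<open>A monomial divisible by y changes only in y-degree at least two, which
        matches the hypothesis on \<open>p\<close>.\<close>
      have "f k * ?M k m = (if k = m then f m else 0)" for k
        using True f0[of k] mfps_nth_prod_power_shear_y_le[OF xy, of m k]
        by (cases "k $ y = 0") auto
      then show ?thesis by (simp add: comp finite_exponent_degree_le p[OF True])
    next
      case False
      define k0 where "k0 = m - ?e"
      have m: "m = k0 + ?e" and k0y: "k0 $ y \<noteq> 0"
        using False by (auto simp: k0_def vec_eq_iff axis_def)
      have deg: "exponent_degree m = Suc (exponent_degree k0)" by (simp add: m)
      have ne: "m \<noteq> k0" using deg by auto
      let ?L = "{j :: nat^'n. exponent_degree j < exponent_degree k0}"
      have L: "f k * ?M k m = (if k = m then f m else 0) + (if k = k0 then of_nat (k0 $ y) * f k0 else 0)"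
        if "k \<in> ?D (exponent_degree m) - ?L" for k
        using that mfps_nth_prod_power_shear_low_degree[OF xy, of m k, where 'a = complex] deg
        by (auto simp: m)
      have "(\<Sum>k\<in>?D (exponent_degree m). f k * ?M k m)
          = (\<Sum>k\<in>?D (exponent_degree m) - ?L. f k * ?M k m) + (\<Sum>k\<in>?L. f k * ?M k m)"
        by (rule sum.subset_diff) (auto simp: finite_exponent_degree_le deg)
      also have "(\<Sum>k\<in>?D (exponent_degree m) - ?L. f k * ?M k m) = f m + of_nat (k0 $ y) * f k0"
        by (subst sum.cong[OF refl L]) (auto simp: sum.distrib finite_exponent_degree_le deg)
      also have "of_nat (k0 $ y) * f k0 = mfps_nth p m - (\<Sum>j\<in>?L. f j * ?M j m)"
        using k0y by (subst f) (simp add: m)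
      finally show ?thesis by (simp add: comp)
    qed
  qed
  then show ?thesis by (rule that)
qed

text \<open>\<open>G\<close> stands for the expansion of \<open>1 / (1 - x y')\<close>; it is
  specified by \<open>(1 - mfps_X x * shifted_var y) * G = 1\<close> wherever the conjugacy is
  studied.\<close>

definition moebius_mfps :: "'n \<Rightarrow> 'n \<Rightarrow> ('a::comm_ring_1, 'n::finite) mfps \<Rightarrow> ('a, 'n) mfps ^ 'n" where
  "moebius_mfps x y G = (\<chi> i. if i = x then mfps_X x * G
     else if i = y then shifted_var y else mfps_X i)"

text \<open>The computation in the coordinate \<open>1/x\<close> has to be cleared of denominators.
  \<open>S\<close> plays the role of \<open>x / (1 + x h)\<close>, and \<open>T\<close> is the
  x-component of the second map after \<open>\<sigma>\<close>. Both \<open>S\<close> after the shear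
  and \<open>T\<close> give \<open>?x1\<close> when multiplied by the unit
  \<open>1 + ?x1 * (h + p)\<close>, hence they agree.\<close>

lemma exists_formal_conjugacy:
  fixes G :: "(complex, 'n::finite) mfps"
  assumes xy: "x \<noteq> y" and G: "(1 - mfps_X x * shifted_var y) * G = 1"
  shows "\<exists>\<sigma>\<in>formal_Diff. formal_comp \<sigma> (shear_mfps x y) = formal_comp (moebius_mfps x y G) \<sigma>"
proof -
  let ?X = "mfps_X x :: (complex, 'n) mfps" and ?Y = "shifted_var y :: (complex, 'n) mfps"
  obtain W where W: "(1 + ?X * ?Y) * W = 1"
    using mfps_right_inverse[of "1 + ?X * ?Y"] by (auto simp: mfps_nth_one)
  \<comment> \<open>With \<open>x1\<close> the x-component of the shear, \<open>p\<close> is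
    \<open>(1/x - y') - 1/x1\<close>: the defect between the two maps in the coordinate
    \<open>1/x\<close>. \<open>W\<close> is the inverse of \<open>1 + x y'\<close>.\<close>
  define p where "p = - (?X * ?Y ^ 2 * W)"
  have p_eq: "(1 + ?X * ?Y) * p = - (?X * ?Y ^ 2)"
  proof -
    have "(1 + ?X * ?Y) * p = - (?X * ?Y ^ 2 * ((1 + ?X * ?Y) * W))"
      by (simp add: p_def algebra_simps)
    then show ?thesis by (simp add: W)
  qed
  have "p = mfps_monom (axis y 2) * (- (?X * (1 + mfps_X y) ^ 2 * W))"
    by (simp add: p_def shifted_var_def power_mult_distrib mfps_X_power)
  then have "mfps_nth p m = 0" if "m $ y < 2" for m
    using that by (simp add: mfps_nth_monom_mult_eq_0[of m y])
  then obtain h where h: "mfps_compose h (shear_mfps x y) = h + p"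
    using shear_difference_equation[OF xy] by metis
  obtain S' where S': "(1 + ?X * h) * S' = 1" "mfps_nth S' 0 = 1"
    using mfps_right_inverse[of "1 + ?X * h"] by (auto simp: mfps_nth_one)
  define S where "S = ?X * S'"
  have S: "(1 + ?X * h) * S = ?X" by (simp add: S_def mult.left_commute[of _ ?X] S'(1))
  define \<sigma> where "\<sigma> = (\<chi> i. if i = x then S else mfps_X i)"
  have \<sigma>0: "mfps_nth (\<sigma> $ i) 0 = 0" for i by (simp add: \<sigma>_def S_def)
  define T where "T = mfps_compose (?X * G) \<sigma>"
  let ?x1 = "?X * (1 + ?X * ?Y)"
  have Y\<sigma>: "mfps_compose ?Y \<sigma> = ?Y"
  proof -
    have "\<sigma> $ y = mfps_X y" using xy by (simp add: \<sigma>_def)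
    then show ?thesis
      by (simp add: shifted_var_def mfps_compose_mult[OF \<sigma>0] mfps_compose_add
          mfps_compose_1[OF \<sigma>0] mfps_compose_X[OF \<sigma>0])
  qed
  have "?X * G * (1 - ?X * ?Y) = ?X * ((1 - ?X * ?Y) * G)" by (simp only: mult_ac)
  then have "?X * G * (1 - ?X * ?Y) = ?X" by (simp only: G mult_1_right)
  then have "mfps_compose (?X * G * (1 - ?X * ?Y)) \<sigma> = mfps_compose ?X \<sigma>" by simp
  then have "T * (1 - S * ?Y) = S"
    unfolding mfps_compose_mult[OF \<sigma>0] mfps_compose_diff Y\<sigma> T_def
      mfps_compose_1[OF \<sigma>0] mfps_compose_X[OF \<sigma>0] by (simp add: \<sigma>_def)
  moreover have "T * (1 + ?X * h - (1 + ?X * h) * S * ?Y) = T * (1 - S * ?Y) * (1 + ?X * h)"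
    by (simp add: algebra_simps)
  ultimately have "T * (1 + ?X * h - ?X * ?Y) = ?X"
    using S by (simp add: mult.commute)
  \<comment> \<open>This is \<open>1/x1 + h + p = 1/x + h - y'\<close> multiplied by
    \<open>?x1\<close>.\<close>
  moreover have "1 + ?x1 * (h + p) = (1 + ?X * ?Y) * (1 + ?X * h - ?X * ?Y)"
  proof -
    have "1 + ?x1 * (h + p) = 1 + ?x1 * h + ?X * ((1 + ?X * ?Y) * p)"
      by (simp add: algebra_simps)
    then show ?thesis unfolding p_eq by (simp add: algebra_simps power2_eq_square)
  qed
  ultimately have T: "(1 + ?x1 * (h + p)) * T = ?x1"
    using mult.assoc[of "1 + ?X * ?Y" "1 + ?X * h - ?X * ?Y" T]
    by (simp only: mult.commute[of _ T] mult.commute[of _ ?X])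
  have "mfps_compose ((1 + ?X * h) * S) (shear_mfps x y) = mfps_compose ?X (shear_mfps x y)"
    by (simp add: S)
  then have "(1 + ?x1 * (h + p)) * mfps_compose S (shear_mfps x y) = ?x1"
    unfolding mfps_compose_mult[OF shear_mfps_0] mfps_compose_add h
      mfps_compose_1[OF shear_mfps_0] mfps_compose_X[OF shear_mfps_0] by (simp add: shear_mfps_def)
  then have ST': "(1 + ?x1 * (h + p)) * mfps_compose S (shear_mfps x y) = (1 + ?x1 * (h + p)) * T"
    by (simp only: T)
  have "mfps_nth (1 + ?x1 * (h + p)) 0 = 1"
    by (simp only: mfps_nth_add mfps_nth_mult_zero mfps_nth_X_0 mfps_nth_one mult_zero_left) simp
  from mfps_mult_unit_cancel[OF this ST'] have ST: "mfps_compose S (shear_mfps x y) = T" .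
  have "mfps_compose (\<sigma> $ i) (shear_mfps x y) = mfps_compose (moebius_mfps x y G $ i) \<sigma>" for i
  proof -
    consider "i = x" | "i = y" | "i \<noteq> x" "i \<noteq> y" by blast
    then show ?thesis
    proof cases
      case 1
      then show ?thesis using ST by (simp add: \<sigma>_def moebius_mfps_def T_def)
    next
      case 2
      then have "\<sigma> $ i = mfps_X y" "moebius_mfps x y G $ i = ?Y" "shear_mfps x y $ y = ?Y"
        using xy by (simp_all add: \<sigma>_def moebius_mfps_def shear_mfps_def)
      then show ?thesis by (simp add: mfps_compose_X[OF shear_mfps_0] Y\<sigma>)
    next
      case 3
      then have "\<sigma> $ i = mfps_X i" "moebius_mfps x y G $ i = mfps_X i" "shear_mfps x y $ i = mfps_X i"
        by (simp_all add: \<sigma>_def moebius_mfps_def shear_mfps_def)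
      then show ?thesis by (simp add: mfps_compose_X[OF shear_mfps_0] mfps_compose_X[OF \<sigma>0])
    qed
  qed
  then have "formal_comp \<sigma> (shear_mfps x y) = formal_comp (moebius_mfps x y G) \<sigma>"
    by (simp add: formal_comp_def)
  moreover have "(\<chi> j i. mfps_nth (\<sigma> $ j) (axis i 1)) = (mat 1 :: complex^'n^'n)"
  proof -
    have "mfps_nth S (axis i 1) = (if i = x then 1 else 0)" for i
    proof (cases "i = x")
      case True
      then show ?thesis
        using mfps_nth_monom_mult_add[of "axis x 1" S' 0] by (simp add: S_def mfps_X_def S'(2))
    next
      case False
      then have "axis i 1 $ x < (axis x 1 :: nat^'n) $ x" by (simp add: axis_def)
      with False show ?thesis unfolding S_def mfps_X_def
        by (simp only: mfps_nth_monom_mult_eq_0 if_False)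
    qed
    then have "mfps_nth (\<sigma> $ j) (axis i 1) = (if j = i then 1 else 0)" for i j
      by (cases "j = x") (auto simp: \<sigma>_def mfps_X_def mfps_nth_monom axis_eq_axis)
    then show ?thesis by (simp add: mat_def)
  qed
  then have "\<sigma> \<in> formal_Diff"
    using \<sigma>0 unfolding formal_Diff_def
    by (simp add: invertible_def)
  ultimately show ?thesis by blast
qed


section \<open>Convergent power series\<close>

definition monom_val :: "complex^'n::finite \<Rightarrow> nat^'n \<Rightarrow> complex" where
  "monom_val z m = (\<Prod>i\<in>UNIV. (z $ i) ^ (m $ i))"

lemma monom_val_add: "monom_val z (a + b) = monom_val z a * monom_val z b"
  by (simp add: monom_val_def power_add prod.distrib)

lemma monom_val_axis: "monom_val z (axis i k) = (z $ i) ^ k"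
proof -
  have "monom_val z (axis i k) = (\<Prod>j\<in>UNIV. if j = i then (z $ i) ^ k else 1)"
    unfolding monom_val_def by (rule prod.cong) (auto simp: axis_def)
  also have "\<dots> = (z $ i) ^ k" by simp
  finally show ?thesis .
qed

lemma has_mfps_expansion_alt:
  "f has_mfps_expansion F \<longleftrightarrow>
     (\<forall>\<^sub>F z in nhds 0. ((\<lambda>m. mfps_nth F m * monom_val z m) has_sum f z) UNIV)"
  by (simp add: has_mfps_expansion_def monom_val_def)

lemma has_mfps_expansion_monom: "(\<lambda>z. monom_val z k) has_mfps_expansion mfps_monom k"
  unfolding has_mfps_expansion_alt
proof (rule always_eventually, rule allI)
  fix z :: "complex^'a"
  have "((\<lambda>m. mfps_nth (mfps_monom k) m * monom_val z m) has_sum monom_val z k) {k}"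
    using has_sum_finite[of "{k}" "\<lambda>m. mfps_nth (mfps_monom k) m * monom_val z m"]
    by (simp add: mfps_nth_monom)
  then show "((\<lambda>m. mfps_nth (mfps_monom k) m * monom_val z m) has_sum monom_val z k) UNIV"
    by (rule has_sum_cong_neutral[THEN iffD1, rotated -1]) (auto simp: mfps_nth_monom)
qed

lemma has_mfps_expansion_X: "(\<lambda>z. z $ i) has_mfps_expansion mfps_X i"
  using has_mfps_expansion_monom[of "axis i 1"] by (simp add: mfps_X_def monom_val_axis)

lemma has_mfps_expansion_1: "(\<lambda>z. 1) has_mfps_expansion 1"
  using has_mfps_expansion_monom[of 0] by (simp add: mfps_monom_0 monom_val_def)

lemma has_mfps_expansion_add:
  assumes "f has_mfps_expansion F" "g has_mfps_expansion G"
  shows "(\<lambda>z. f z + g z) has_mfps_expansion (F + G)"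
  using assms unfolding has_mfps_expansion_alt
  by eventually_elim (simp add: distrib_right has_sum_add)

lemma has_mfps_expansion_uminus:
  assumes "f has_mfps_expansion F"
  shows "(\<lambda>z. - f z) has_mfps_expansion (- F)"
  using assms unfolding has_mfps_expansion_alt
  by eventually_elim (simp add: has_sum_uminus)

lemma has_mfps_expansion_diff:
  assumes "f has_mfps_expansion F" "g has_mfps_expansion G"
  shows "(\<lambda>z. f z - g z) has_mfps_expansion (F - G)"
  using has_mfps_expansion_add[OF assms(1) has_mfps_expansion_uminus[OF assms(2)]]
  by simp

text \<open>Over the complex numbers summability is absolute, so the products form a summable family
  on pairs. Its sum is \<open>a * b\<close> when computed iteratively, and the same sum may be
  regrouped along \<open>p + q = m\<close>.\<close>

lemma has_sum_Cauchy_product: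
  fixes f g :: "nat^'n::finite \<Rightarrow> complex"
  assumes f: "(f has_sum a) UNIV" and g: "(g has_sum b) UNIV"
  shows "((\<lambda>m. \<Sum>(p, q) | p + q = m. f p * g q) has_sum (a * b)) UNIV"
proof -
  have fa: "(\<lambda>m. norm (f m)) summable_on UNIV" and ga: "(\<lambda>m. norm (g m)) summable_on UNIV"
    using f g by (auto simp flip: summable_on_iff_abs_summable_on_complex simp: has_sum_imp_summable)
  have gs: "((\<lambda>q. f p * g q) has_sum f p * b) UNIV" for p
    using g by (rule has_sum_cmult_right)
  have "(\<lambda>(p, q). f p * g q) summable_on UNIV \<times> UNIV"
  proof -
    have "(\<lambda>x. norm ((\<lambda>(p, q). f p * g q) x)) summable_on (UNIV \<times> UNIV)"
    proof (rule Infinite_Sum.abs_summable_on_Sigma_iff[THEN iffD2], intro conjI ballI)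
      show "(\<lambda>q. norm (case (p, q) of (p, q) \<Rightarrow> f p * g q)) summable_on UNIV" for p
        using ga by (simp add: norm_mult summable_on_cmult_right)
      show "(\<lambda>p. norm (\<Sum>\<^sub>\<infinity>q\<in>UNIV. norm (case (p, q) of (p, q) \<Rightarrow> f p * g q))) summable_on UNIV"
        using fa by (simp add: norm_mult infsum_cmult_right' summable_on_cmult_left abs_mult infsum_nonneg)
    qed
    then show ?thesis by (simp add: summable_on_iff_abs_summable_on_complex)
  qed
  then obtain s where s: "((\<lambda>(p, q). f p * g q) has_sum s) (UNIV \<times> UNIV)"
    by (auto simp: summable_on_def)
  have "((\<lambda>p. f p * b) has_sum s) UNIV"
    by (rule has_sum_Sigma'[OF s]) (simp add: gs)
  moreover have "((\<lambda>p. f p * b) has_sum a * b) UNIV"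
    using f by (rule has_sum_cmult_left)
  ultimately have "s = a * b" by (rule has_sum_unique)
  have "((\<lambda>(m, p, q). f p * g q) has_sum s) (Sigma UNIV (\<lambda>m. {(p, q). p + q = m}))"
    by (subst has_sum_reindex_bij_witness[of _ "\<lambda>(p, q). (p + q, p, q)" snd "UNIV \<times> UNIV"
          "\<lambda>(p, q). f p * g q" _ s s])
       (use s in auto)
  then have "((\<lambda>m. \<Sum>(p, q) | p + q = m. f p * g q) has_sum s) UNIV"
  proof (rule has_sum_Sigma')
    fix m :: "nat^'n"
    show "((\<lambda>y. case (m, y) of (m, p, q) \<Rightarrow> f p * g q)
        has_sum (\<Sum>(p, q) | p + q = m. f p * g q)) {(p, q). p + q = m}"
      using has_sum_finite[OF finite_exponents_add[of m], of "\<lambda>(p, q). f p * g q"] by simp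
  qed
  then show ?thesis by (simp add: \<open>s = a * b\<close>)
qed

lemma has_sum_monom_val_mult:
  assumes "((\<lambda>m. mfps_nth F m * monom_val z m) has_sum a) UNIV"
    and "((\<lambda>m. mfps_nth G m * monom_val z m) has_sum b) UNIV"
  shows "((\<lambda>m. mfps_nth (F * G) m * monom_val z m) has_sum a * b) UNIV"
proof -
  have "(\<Sum>(p, q) | p + q = m. (mfps_nth F p * monom_val z p) * (mfps_nth G q * monom_val z q))
      = mfps_nth (F * G) m * monom_val z m" for m
    unfolding mfps_nth_mult sum_distrib_right
    by (rule sum.cong) (auto simp: monom_val_add mult_ac)
  with has_sum_Cauchy_product[OF assms] show ?thesis by simp
qed

lemma has_mfps_expansion_mult:
  assumes "f has_mfps_expansion F" "g has_mfps_expansion G"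
  shows "(\<lambda>z. f z * g z) has_mfps_expansion (F * G)"
  using assms unfolding has_mfps_expansion_alt
proof eventually_elim
  case (elim z)
  then show ?case by (rule has_sum_monom_val_mult)
qed

lemma summable_on_monom_val_le:
  assumes "(\<lambda>m. F m * monom_val (\<chi> i. of_real r) m) summable_on UNIV"
    and "\<And>i. norm (z $ i) \<le> r"
  shows "(\<lambda>m. F m * monom_val z m) summable_on UNIV"
proof -
  have "norm (F m * monom_val z m) \<le> norm (F m * monom_val (\<chi> i. of_real r) m)" for m
  proof -
    have "norm (monom_val z m) \<le> norm (monom_val (\<chi> i. of_real r) m)"
      unfolding monom_val_def norm_mult[symmetric] prod_norm[symmetric]
      using assms(2) by (intro prod_mono) (auto simp: norm_power intro!: power_mono order_trans[OF assms(2)])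
    then show ?thesis by (simp add: norm_mult mult_left_mono)
  qed
  then show ?thesis
    using assms(1) unfolding summable_on_iff_abs_summable_on_complex
    by (rule_tac Infinite_Sum.abs_summable_on_comparison_test')
qed

section \<open>Polydiscs as neighbourhoods of the origin\<close>

lemma eventually_nhds_0_polydisc:
  assumes "\<forall>\<^sub>F z :: complex^'n::finite in nhds 0. P z"
  obtains r where "r > 0" "\<And>z. (\<And>i. norm (z $ i) \<le> r) \<Longrightarrow> P z"
proof -
  obtain e where e: "e > 0" "\<And>z. dist z 0 < e \<Longrightarrow> P z"
    using assms by (auto simp: eventually_nhds_metric)
  define r where "r = e / (2 * real CARD('n))"
  have "r > 0" using e(1) by (simp add: r_def)
  moreover have "P z" if "\<And>i. norm (z $ i) \<le> r" for z :: "complex^'n"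
  proof -
    have "norm z \<le> (\<Sum>i\<in>UNIV. norm (z $ i))" unfolding norm_vec_def by (rule L2_set_le_sum) simp
    also have "\<dots> \<le> real CARD('n) * r" using that by (rule sum_bounded_above)
    also have "\<dots> < e" using e(1) by (simp add: r_def)
    finally show ?thesis using e(2) by simp
  qed
  ultimately show ?thesis by (rule that)
qed

lemma eventually_nhds_0_polydisc_iff:
  "(\<forall>\<^sub>F z :: complex^'n::finite in nhds 0. P z) \<longleftrightarrow>
     (\<exists>r>0. \<forall>z. (\<forall>i. norm (z $ i) \<le> r) \<longrightarrow> P z)"
proof
  assume "\<exists>r>0. \<forall>z. (\<forall>i. norm (z $ i) \<le> r) \<longrightarrow> P z"
  then obtain r where r: "r > 0" "\<And>z. (\<And>i. norm (z $ i) \<le> r) \<Longrightarrow> P z" by blast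
  have "P z" if "dist z 0 < r" for z :: "complex^'n"
    using that by (intro r(2)) (auto intro: order_trans[OF Finite_Cartesian_Product.norm_nth_le])
  then show "\<forall>\<^sub>F z in nhds 0. P z" using r(1) by (auto simp: eventually_nhds_metric)
qed (metis eventually_nhds_0_polydisc)

text \<open>Substituting a monomial into a one-variable series only reindexes it: the exponents
  \<open>n * k\<close> are distinct since \<open>k $ i \<noteq> 0\<close>, so each coefficient sum
  has at most one term. The bound 1/2 keeps the other factors at most 1, whence the monomial is no
  larger than \<open>z $ i\<close> and stays inside the disc of radius \<open>R\<close>.\<close>

lemma has_mfps_expansion_monom_series:
  fixes g :: "complex \<Rightarrow> complex" and k :: "nat^'n::finite"
  assumes g: "\<And>t. norm t < R \<Longrightarrow> (\<lambda>n. c n * t ^ n) sums g t" and R: "R > 0" and i: "k $ i \<noteq> 0"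
  shows "(\<lambda>z. g (monom_val z k)) has_mfps_expansion
    Abs_mfps (\<lambda>m. \<Sum>n | (\<chi> j. n * k $ j) = m. c n)"
  unfolding has_mfps_expansion_alt eventually_nhds_0_polydisc_iff
proof (intro exI[of _ "min (1/2) (R/2)"] conjI allI impI)
  fix z :: "complex^'n" assume z: "\<forall>i. norm (z $ i) \<le> min (1/2) (R/2)"
  let ?h = "\<lambda>n. (\<chi> j. n * k $ j) :: nat^'n" and ?F = "\<lambda>m. \<Sum>n | (\<chi> j. n * k $ j) = (m :: nat^'n). c n"
  have z1: "norm (z $ j) \<le> 1" for j using z[rule_format, of j] by simp
  have inj: "inj ?h" using i by (auto simp: inj_def vec_eq_iff)
  have Fh: "?F (?h n) = c n" for n
  proof -
    have "{n'. ?h n' = ?h n} = {n}" using inj by (auto simp: inj_def)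
    then show ?thesis by simp
  qed
  have mv: "monom_val z (?h n) = monom_val z k ^ n" for n
    by (simp add: monom_val_def prod_power_distrib mult.commute[of n] power_mult)
  define t where "t = monom_val z k"
  have "norm t \<le> norm (z $ i) ^ (k $ i)"
  proof -
    have "norm t = norm (z $ i) ^ (k $ i) * (\<Prod>j\<in>UNIV - {i}. norm (z $ j) ^ (k $ j))"
      by (simp add: t_def monom_val_def norm_power norm_mult prod.remove[of UNIV i] prod_norm[symmetric])
    also have "\<dots> \<le> norm (z $ i) ^ (k $ i) * 1"
      using z1 by (intro mult_left_mono prod_le_1) (auto intro!: power_le_one)
    finally show ?thesis by simp
  qed
  also have "\<dots> \<le> norm (z $ i) ^ 1"
    using i z1 by (intro power_decreasing) auto
  also have "\<dots> \<le> R / 2" using z by auto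
  finally have t: "norm t < R" using R by simp
  \<comment> \<open>Absolute convergence at \<open>t\<close> follows from convergence at the larger
    radius halfway between \<open>norm t\<close> and \<open>R\<close>.\<close>
  have "summable (\<lambda>n. norm (c n * t ^ n))"
  proof (rule powser_insidea)
    show "summable (\<lambda>n. c n * of_real ((norm t + R) / 2) ^ n)"
      using t R by (intro sums_summable[OF g]) (simp add: field_simps flip: of_real_add)
    show "norm t < norm (of_real ((norm t + R) / 2) :: complex)"
      using t R by (simp flip: of_real_add add: norm_divide)
  qed
  then have "((\<lambda>n. c n * t ^ n) has_sum g t) UNIV"
    by (intro norm_summable_imp_has_sum g t)
  then have range: "((\<lambda>m. ?F m * monom_val z m) has_sum g t) (range ?h)"
    unfolding has_sum_reindex[OF inj] o_def Fh mv by (simp add: t_def)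
  have "?F m = 0" if "m \<notin> range ?h" for m
    using that by (intro sum.neutral) auto
  then have "((\<lambda>m. ?F m * monom_val z m) has_sum g t) UNIV"
    by (intro has_sum_cong_neutral[THEN iffD1, OF _ _ _ range]) auto
  then show "((\<lambda>m. mfps_nth (Abs_mfps ?F) m * monom_val z m) has_sum g (monom_val z k)) UNIV"
    by (simp add: t_def)
qed (use R in simp)

text \<open>A majorant argument on \<open>U = 1 + F * U\<close>. On a polydisc where the absolute
  values of the terms of \<open>F\<close> sum to at most 1/2, a partial sum b of those of
  \<open>U\<close> obeys \<open>b \<le> 1 + b / 2\<close>, so it is at most 2. The sum u of
  \<open>U\<close> then satisfies \<open>u = 1 + f z * u\<close>, which also excludes
  \<open>f z = 1\<close>.\<close>

lemma convergent_mfps_inverse: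
  fixes F U :: "(complex, 'n::finite) mfps"
  assumes f: "f has_mfps_expansion F" and F0: "mfps_nth F 0 = 0" and U: "(1 - F) * U = 1"
  shows "(\<lambda>z. 1 / (1 - f z)) has_mfps_expansion U"
proof -
  let ?v = "\<lambda>s :: real. monom_val (\<chi> i. of_real s) :: nat^'n \<Rightarrow> complex"
  have v: "?v s m = of_real (s ^ exponent_degree m)" for s m
    by (simp add: monom_val_def exponent_degree_def power_sum)
  obtain r where r: "r > 0" "\<And>z. (\<And>i. norm (z $ i) \<le> r) \<Longrightarrow>
      ((\<lambda>m. mfps_nth F m * monom_val z m) has_sum f z) UNIV"
    by (rule eventually_nhds_0_polydisc[OF f[unfolded has_mfps_expansion_alt]]) blast
  have "(\<lambda>m. mfps_nth F m * ?v r m) summable_on UNIV"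
    by (rule has_sum_imp_summable[OF r(2)]) (use r(1) in auto)
  then have sr: "(\<lambda>m. norm (mfps_nth F m) * r ^ exponent_degree m) summable_on UNIV"
    unfolding summable_on_iff_abs_summable_on_complex using r(1) by (simp add: norm_mult norm_power v)
  define B where "B = (\<Sum>\<^sub>\<infinity>m. norm (mfps_nth F m) * r ^ exponent_degree m)"
  have B0: "B \<ge> 0" using r(1) by (auto simp: B_def intro: infsum_nonneg)
  \<comment> \<open>As \<open>F\<close> has no constant term, shrinking the radius by a factor
    \<open>\<epsilon> \<le> 1\<close> shrinks its majorant by at least the same factor; this choice
    brings \<open>\<epsilon> * B\<close> below 1/2.\<close>
  define \<epsilon> where "\<epsilon> = 1 / (2 * (B + 1))"
  define s where "s = \<epsilon> * r"
  have \<epsilon>: "0 < \<epsilon>" "\<epsilon> \<le> 1" "\<epsilon> * B \<le> 1 / 2" using B0 by (auto simp: \<epsilon>_def field_simps)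
  have s: "0 < s" "s \<le> r" using \<epsilon> r(1) by (auto simp: s_def)
  let ?a = "\<lambda>m. norm (mfps_nth F m) * s ^ exponent_degree m"
  let ?u = "\<lambda>m. norm (mfps_nth U m) * s ^ exponent_degree m"
  have Fs: "sum ?a A \<le> 1 / 2" if "finite A" for A
  proof -
    have "?a m \<le> \<epsilon> * (norm (mfps_nth F m) * r ^ exponent_degree m)" for m
    proof (cases "m = 0")
      case False
      then have "\<epsilon> ^ exponent_degree m \<le> \<epsilon> ^ 1" using \<epsilon> by (intro power_decreasing) (auto simp: Suc_le_eq zero_less_iff_neq_zero)
      then have "\<epsilon> ^ exponent_degree m * (norm (mfps_nth F m) * r ^ exponent_degree m)
          \<le> \<epsilon> * (norm (mfps_nth F m) * r ^ exponent_degree m)"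
        using r(1) by (intro mult_right_mono) auto
      then show ?thesis by (simp add: s_def power_mult_distrib mult_ac)
    qed (simp add: F0)
    then have "sum ?a A \<le> \<epsilon> * (\<Sum>m\<in>A. norm (mfps_nth F m) * r ^ exponent_degree m)"
      by (simp add: sum_distrib_left sum_mono)
    also have "\<dots> \<le> \<epsilon> * B"
      unfolding B_def using \<epsilon> r(1) that sr by (intro mult_left_mono finite_sum_le_infsum) auto
    finally show ?thesis using \<epsilon> by simp
  qed
  let ?D = "\<lambda>d. {m :: nat^'n. exponent_degree m \<le> d}"
  have finD: "finite (?D d)" for d by (rule finite_exponent_degree_le)
  have U0: "mfps_nth U m = mfps_nth 1 m + mfps_nth (F * U) m" for m
  proof -
    have "U = 1 + F * U" using U by (simp add: algebra_simps)
    then show ?thesis by (metis mfps_nth_add)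
  qed
  have bound: "(\<Sum>m\<in>?D d. ?u m) \<le> 2" for d
  proof -
    have u: "?u m \<le> (if m = 0 then 1 else 0) + (\<Sum>(p, q) | p + q = m. ?a p * ?u q)" for m
    proof -
      have "norm (mfps_nth U m) \<le> norm (mfps_nth 1 m :: complex) + norm (mfps_nth (F * U) m)"
        by (subst U0) (rule norm_triangle_ineq)
      also have "norm (mfps_nth (F * U) m) \<le> (\<Sum>(p, q) | p + q = m. norm (mfps_nth F p) * norm (mfps_nth U q))"
        unfolding mfps_nth_mult
        by (rule order_trans[OF norm_sum]) (simp add: case_prod_unfold norm_mult)
      finally have "?u m \<le> (norm (mfps_nth 1 m :: complex)
          + (\<Sum>(p, q) | p + q = m. norm (mfps_nth F p) * norm (mfps_nth U q))) * s ^ exponent_degree m"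
        using s by (intro mult_right_mono) auto
      also have "\<dots> = (if m = 0 then 1 else 0) + (\<Sum>(p, q) | p + q = m. ?a p * ?u q)"
      proof -
        have "(\<Sum>(p, q) | p + q = m. norm (mfps_nth F p) * norm (mfps_nth U q)) * s ^ exponent_degree m
            = (\<Sum>(p, q) | p + q = m. ?a p * ?u q)"
          unfolding sum_distrib_right by (rule sum.cong) (auto simp: power_add mult_ac)
        then show ?thesis by (simp add: distrib_right mfps_nth_one)
      qed
      finally show ?thesis .
    qed
    have "(\<Sum>m\<in>?D d. ?u m) \<le> (\<Sum>m\<in>?D d. (if m = 0 then 1 else 0) + (\<Sum>(p, q) | p + q = m. ?a p * ?u q))"
      by (intro sum_mono u)
    also have "\<dots> = 1 + (\<Sum>m\<in>?D d. \<Sum>(p, q) | p + q = m. ?a p * ?u q)"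
      by (simp add: sum.distrib finD)
    also have "(\<Sum>m\<in>?D d. \<Sum>(p, q) | p + q = m. ?a p * ?u q)
        = (\<Sum>(m, p, q)\<in>Sigma (?D d) (\<lambda>m. {(p, q). p + q = m}). ?a p * ?u q)"
      by (rule sum.Sigma[OF finD]) (auto simp: finite_exponents_add)
    also have "\<dots> = (\<Sum>(p, q)\<in>{(p, q). exponent_degree (p + q) \<le> d}. ?a p * ?u q)"
      by (rule sum.reindex_bij_witness[where i = "\<lambda>(p, q). (p + q, p, q)" and j = snd]) auto
    also have "\<dots> \<le> (\<Sum>(p, q)\<in>?D d \<times> ?D d. ?a p * ?u q)"
      using s by (intro sum_mono2) (auto simp: finD)
    also have "\<dots> = sum ?a (?D d) * sum ?u (?D d)"
      by (simp add: sum_product sum.cartesian_product)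
    also have "\<dots> \<le> 1 / 2 * sum ?u (?D d)"
      using s by (intro mult_right_mono Fs finD sum_nonneg) auto
    finally show ?thesis by simp
  qed
  have "?u summable_on UNIV"
  proof (rule nonneg_bdd_above_summable_on)
    show "bdd_above (sum ?u ` {A. A \<subseteq> UNIV \<and> finite A})"
    proof (rule bdd_aboveI2)
      fix A :: "(nat^'n) set" assume A: "A \<in> {A. A \<subseteq> UNIV \<and> finite A}"
      then have "A \<subseteq> ?D (Max (exponent_degree ` A))" by auto
      then have "sum ?u A \<le> sum ?u (?D (Max (exponent_degree ` A)))"
        using s by (intro sum_mono2 finD) auto
      also have "\<dots> \<le> 2" by (rule bound)
      finally show "sum ?u A \<le> 2" .
    qed
  qed (use s in auto)
  then have Us: "(\<lambda>m. mfps_nth U m * ?v s m) summable_on UNIV"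
    unfolding summable_on_iff_abs_summable_on_complex using s by (simp add: norm_mult norm_power v)
  show ?thesis
    unfolding has_mfps_expansion_alt eventually_nhds_0_polydisc_iff
  proof (intro exI[of _ s] conjI allI impI)
    fix z :: "complex^'n" assume z: "\<forall>i. norm (z $ i) \<le> s"
    let ?U = "\<lambda>m. mfps_nth U m * monom_val z m"
    obtain u where u: "(?U has_sum u) UNIV"
      using summable_on_monom_val_le[OF Us] z by (auto simp: summable_on_def)
    have fz: "((\<lambda>m. mfps_nth F m * monom_val z m) has_sum f z) UNIV"
      using z s by (intro r(2)) (auto intro: order_trans)
    from fz u have "((\<lambda>m. mfps_nth (F * U) m * monom_val z m) has_sum f z * u) UNIV"
      by (rule has_sum_monom_val_mult)
    moreover have "((\<lambda>m. mfps_nth 1 m * monom_val z m) has_sum 1) UNIV"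
    proof -
      have "((\<lambda>m. mfps_nth 1 m * monom_val z m) has_sum 1) {0}"
        using has_sum_finite[of "{0}" "\<lambda>m. mfps_nth 1 m * monom_val z m"]
        by (simp add: mfps_nth_one monom_val_def)
      then show ?thesis
        by (rule has_sum_cong_neutral[THEN iffD1, rotated -1]) (auto simp: mfps_nth_one)
    qed
    ultimately have "((\<lambda>m. mfps_nth 1 m * monom_val z m + mfps_nth (F * U) m * monom_val z m)
        has_sum 1 + f z * u) UNIV"
      by (intro has_sum_add)
    then have "(?U has_sum 1 + f z * u) UNIV" by (simp add: U0 flip: distrib_right)
    with u have "u = 1 + f z * u" by (rule has_sum_unique)
    then have "u * (1 - f z) = 1" by (simp add: algebra_simps)
    then have "u = 1 / (1 - f z)" by (metis nonzero_eq_divide_eq mult_zero_right zero_neq_one)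
    with u show "(?U has_sum 1 / (1 - f z)) UNIV" by simp
  qed (rule s)
qed


section \<open>The two diffeomorphisms\<close>

definition shear_map :: "'n \<Rightarrow> 'n \<Rightarrow> complex^'n \<Rightarrow> complex^'n" where
  "shear_map x y z = (\<chi> i. if i = x then z $ x * (1 + z $ x * (z $ y * (1 + z $ y)))
     else if i = y then z $ y * (1 + z $ y) else z $ i)"

definition moebius_map :: "'n \<Rightarrow> 'n \<Rightarrow> complex^'n \<Rightarrow> complex^'n" where
  "moebius_map x y z = (\<chi> i. if i = x then z $ x * (1 / (1 - z $ x * (z $ y * (1 + z $ y))))
     else if i = y then z $ y * (1 + z $ y) else z $ i)"

text \<open>\<open>t \<mapsto> t C(t)\<close> is the inverse of \<open>t \<mapsto> t + t\<^sup>2\<close> at \<open>0\<close>.\<close>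

definition catalan_fun :: "complex \<Rightarrow> complex" where
  "catalan_fun t = 2 / (1 + csqrt (1 + 4 * t))"

text \<open>Valid for every \<open>t\<close>: the principal root has nonnegative real part, so the
  denominator never vanishes.\<close>

lemma catalan_fun_eq: "catalan_fun t * (1 + t * catalan_fun t) = 1"
proof -
  define s where "s = csqrt (1 + 4 * t)"
  have t: "t = (s\<^sup>2 - 1) / 4" by (simp add: s_def)
  have "Re s \<ge> 0" using csqrt_principal[of "1 + 4 * t"] by (auto simp only: s_def)
  then have "1 + s \<noteq> 0" by (auto simp: complex_eq_iff)
  then show ?thesis
  proof -
    assume s: "1 + s \<noteq> 0"
    have "t * 2 = (s - 1) / 2 * (1 + s)" by (simp add: t power2_eq_square field_simps)
    then have "t * (2 / (1 + s)) = (s - 1) / 2" using s by (simp add: field_simps)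
    then have "1 + t * (2 / (1 + s)) = (1 + s) / 2" by (simp add: field_simps)
    then have "2 / (1 + s) * (1 + t * (2 / (1 + s))) = 1" using s by simp
    then show ?thesis by (simp only: catalan_fun_def s_def)
  qed
qed

text \<open>The discriminant is the square of \<open>1 + 2 * t\<close>. The bound on
  \<open>t\<close> makes the real part of this number positive and so selects it as the principal
  root.\<close>

lemma catalan_fun_inverse:
  assumes "norm t < 1 / 2"
  shows "catalan_fun (t * (1 + t)) * (1 + t) = 1"
proof -
  have "\<bar>Re t\<bar> \<le> norm t" by (rule abs_Re_le_cmod)
  with assms have Re: "Re (1 + 2 * t) > 0" by simp
  have "csqrt (1 + 4 * (t * (1 + t))) = csqrt ((1 + 2 * t)\<^sup>2)"
    by (simp add: power2_eq_square algebra_simps)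
  also have "\<dots> = 1 + 2 * t" using Re by (intro csqrt_square) simp
  finally have eq: "csqrt (1 + 4 * (t * (1 + t))) = 1 + 2 * t" .
  have "1 + t \<noteq> 0" using assms by (auto simp: add_eq_0_iff)
  then have "2 / (2 * (1 + t)) * (1 + t) = 1" by (metis divide_divide_eq_left div_self nonzero_eq_divide_eq one_add_one zero_neq_numeral)
  moreover have "1 + (1 + 2 * t) = 2 * (1 + t)" by simp
  ultimately show ?thesis unfolding catalan_fun_def eq by simp
qed

text \<open>The radius 1/4 is the distance from 0 to the branch point \<open>-1/4\<close> of the
  root.\<close>

lemma catalan_fun_power_series:
  obtains c where "\<And>t. norm t < 1 / 4 \<Longrightarrow> (\<lambda>n. c n * t ^ n) sums catalan_fun t"
proof -
  have Re: "Re (1 + 4 * t) > 0" if "norm t < 1 / 4" for t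
    using that abs_Re_le_cmod[of t] by simp
  have "catalan_fun holomorphic_on ball 0 (1 / 4)"
    unfolding catalan_fun_def
  proof (intro holomorphic_intros holomorphic_on_csqrt')
    fix t :: complex assume "t \<in> ball 0 (1 / 4)"
    then have *: "Re (1 + 4 * t) > 0" by (intro Re) simp
    then show "1 + 4 * t \<notin> \<real>\<^sub>\<le>\<^sub>0" by (auto simp: complex_nonpos_Reals_iff)
    have "Re (1 + csqrt (1 + 4 * t)) > 0" using csqrt_principal[of "1 + 4 * t"] by (simp del: csqrt.simps) linarith
    then show "1 + csqrt (1 + 4 * t) \<noteq> 0" by force
  qed
  from holomorphic_power_series[OF this] show ?thesis
    by (intro that[of "\<lambda>n. (deriv ^^ n) catalan_fun 0 / fact n"]) simp
qed

lemma has_mfps_expansion_catalan: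
  fixes k :: "nat^'n::finite"
  assumes "k $ i \<noteq> 0"
  obtains F where "(\<lambda>z. catalan_fun (monom_val z k)) has_mfps_expansion F"
proof -
  obtain c where "\<And>t. norm t < 1 / 4 \<Longrightarrow> (\<lambda>n. c n * t ^ n) sums catalan_fun t"
    by (rule catalan_fun_power_series) blast
  from has_mfps_expansion_monom_series[of "1 / 4", OF this _ assms] show ?thesis
    by (rule that) simp_all
qed

lemmas has_mfps_expansion_intros =
  has_mfps_expansion_mult has_mfps_expansion_add has_mfps_expansion_diff
  has_mfps_expansion_uminus has_mfps_expansion_1 has_mfps_expansion_X

lemma has_mfps_expansion_shifted_var:
  "(\<lambda>z. z $ y * (1 + z $ y)) has_mfps_expansion shifted_var y"
  unfolding shifted_var_def by (intro has_mfps_expansion_intros)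

lemma shear_map_has_taylor: "shear_map x y has_taylor shear_mfps x y"
  unfolding has_taylor_def
proof
  fix j show "(\<lambda>z. shear_map x y z $ j) has_mfps_expansion (shear_mfps x y $ j)"
    unfolding shear_map_def shear_mfps_def
    by (auto intro!: has_mfps_expansion_intros has_mfps_expansion_shifted_var)
qed

lemma moebius_map_has_taylor:
  fixes G :: "(complex, 'n::finite) mfps"
  assumes "(1 - mfps_X x * shifted_var y) * G = 1"
  shows "moebius_map x y has_taylor moebius_mfps x y G"
  unfolding has_taylor_def
proof
  have "(\<lambda>z. 1 / (1 - z $ x * (z $ y * (1 + z $ y)))) has_mfps_expansion G"
    by (rule convergent_mfps_inverse[OF _ _ assms])
       (auto intro!: has_mfps_expansion_intros has_mfps_expansion_shifted_var)
  from has_mfps_expansion_mult[OF has_mfps_expansion_X[of x] this]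
  show "(\<lambda>z. moebius_map x y z $ j) has_mfps_expansion (moebius_mfps x y G $ j)" for j
    unfolding moebius_map_def moebius_mfps_def
    by (auto intro!: has_mfps_expansion_intros has_mfps_expansion_shifted_var)
qed

lemma eventually_small_components:
  assumes "e > 0"
  shows "\<forall>\<^sub>F z :: complex^'n::finite in nhds 0. \<forall>i. norm (z $ i) < e"
  unfolding eventually_nhds_0_polydisc_iff
proof (intro exI[of _ "e / 2"] conjI allI impI)
  fix z :: "complex^'n" and i assume "\<forall>i. norm (z $ i) \<le> e / 2"
  then have "norm (z $ i) \<le> e / 2" by blast
  with assms show "norm (z $ i) < e" by simp
qed (use assms in simp)

lemma norm_shifted_mult_bound:
  fixes a b :: complex
  assumes "norm a < 1 / 4" "norm b < 1 / 4"
  shows "norm (a * (b * (1 + b))) < 1 / 2"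
proof -
  have "norm (1 + b) \<le> 2" using assms(2) norm_triangle_ineq[of 1 b] by simp
  then have "norm (b * (1 + b)) \<le> 1 / 4 * 2"
    unfolding norm_mult using assms(2) by (intro mult_mono) auto
  then have "norm (a * (b * (1 + b))) \<le> 1 / 4 * (1 / 4 * 2)"
    unfolding norm_mult[of a] using assms(1) by (intro mult_mono) auto
  then show ?thesis by simp
qed

text \<open>Let (X, Y) be the image of (x, y). Since the x-component is built with y' = Y rather
  than with y, the number \<open>t = x Y\<close> satisfies \<open>X Y = t + t^2\<close>. The same
  function thus inverts both components: \<open>x = X C(X Y)\<close> and \<open>y = Y C(Y)\<close>,
  with C for \<open>catalan_fun\<close>.\<close>

lemma shear_map_analytic_Diff:
  fixes x y :: "'n::finite"
  assumes xy: "x \<noteq> y"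
  shows "shear_map x y \<in> analytic_Diff"
proof -
  define \<psi> :: "complex^'n \<Rightarrow> complex^'n" where
    "\<psi> z = (\<chi> i. if i = x then z $ x * catalan_fun (z $ x * z $ y)
      else if i = y then z $ y * catalan_fun (z $ y) else z $ i)" for z
  obtain F where F: "(\<lambda>z. catalan_fun (monom_val z (axis x 1 + axis y 1))) has_mfps_expansion F"
    by (rule has_mfps_expansion_catalan[of "axis x 1 + axis y 1" x]) (auto simp: axis_def)
  obtain H where H: "(\<lambda>z. catalan_fun (monom_val z (axis y 1))) has_mfps_expansion H"
    by (rule has_mfps_expansion_catalan[of "axis y 1" y]) (auto simp: axis_def)
  have small: "\<forall>\<^sub>F z :: complex^'n in nhds 0. \<forall>i. norm (z $ i) < 1 / 4"
    by (rule eventually_small_components) simp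
  have "\<psi> has_taylor (\<chi> i. if i = x then mfps_X x * F else if i = y then mfps_X y * H else mfps_X i)"
    unfolding has_taylor_def
  proof
    fix j
    show "(\<lambda>z. \<psi> z $ j) has_mfps_expansion
      ((\<chi> i. if i = x then mfps_X x * F else if i = y then mfps_X y * H else mfps_X i) $ j)"
      using F H unfolding \<psi>_def monom_val_add monom_val_axis
      by (auto intro!: has_mfps_expansion_intros)
  qed
  moreover have "\<forall>\<^sub>F z in nhds 0. \<psi> (shear_map x y z) = z"
    using small
  proof eventually_elim
    case (elim z)
    define t where "t = z $ x * (z $ y * (1 + z $ y))"
    have "norm t < 1 / 2" unfolding t_def using elim by (intro norm_shifted_mult_bound) auto
    then have 1: "catalan_fun (t * (1 + t)) * (1 + t) = 1" by (rule catalan_fun_inverse)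
    have "norm (z $ y) < 1 / 2" using elim[rule_format, of y] by simp
    then have 2: "catalan_fun (z $ y * (1 + z $ y)) * (1 + z $ y) = 1" by (rule catalan_fun_inverse)
    have "z $ x * (1 + t) * catalan_fun (z $ x * (1 + t) * (z $ y * (1 + z $ y)))
        = z $ x * (catalan_fun (t * (1 + t)) * (1 + t))"
      by (simp add: t_def mult_ac)
    moreover have "z $ y * (1 + z $ y) * catalan_fun (z $ y * (1 + z $ y))
        = z $ y * (catalan_fun (z $ y * (1 + z $ y)) * (1 + z $ y))"
      by (simp add: mult_ac)
    ultimately show ?case
      using xy 1 2 by (simp add: vec_eq_iff \<psi>_def shear_map_def flip: t_def)
  qed
  moreover have "shear_map x y (\<psi> z) = z" for z
  proof -
    have \<psi>y: "\<psi> z $ y = z $ y * catalan_fun (z $ y)"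
      and \<psi>x: "\<psi> z $ x = z $ x * catalan_fun (z $ x * z $ y)"
      and \<psi>: "\<And>i. i \<noteq> x \<Longrightarrow> i \<noteq> y \<Longrightarrow> \<psi> z $ i = z $ i"
      using xy by (simp_all add: \<psi>_def)
    have 1: "\<psi> z $ y * (1 + \<psi> z $ y) = z $ y"
      unfolding \<psi>y mult.assoc catalan_fun_eq by simp
    have "\<psi> z $ x * (1 + \<psi> z $ x * z $ y)
        = z $ x * (catalan_fun (z $ x * z $ y) * (1 + z $ x * z $ y * catalan_fun (z $ x * z $ y)))"
      by (simp add: \<psi>x mult_ac)
    then have 2: "\<psi> z $ x * (1 + \<psi> z $ x * z $ y) = z $ x"
      unfolding catalan_fun_eq by simp
    show ?thesis
      unfolding shear_map_def 1 2 by (simp add: vec_eq_iff \<psi>)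
  qed
  moreover have "\<psi> 0 = 0" "shear_map x y 0 = 0"
    by (simp_all add: vec_eq_iff \<psi>_def shear_map_def)
  ultimately show ?thesis
    using shear_map_has_taylor[of x y] unfolding analytic_Diff_def
    by (auto intro!: exI[of _ \<psi>])
qed

lemma moebius_map_analytic_Diff:
  fixes x y :: "'n::finite"
  assumes xy: "x \<noteq> y"
  shows "moebius_map x y \<in> analytic_Diff"
proof -
  \<comment> \<open>\<open>X = x / (1 - x Y)\<close> is solved by \<open>x = X / (1 + X Y)\<close>.
    The denominator is spelled \<open>1 - (- ...)\<close> to fit
    \<open>convergent_mfps_inverse\<close>.\<close>
  define \<psi> :: "complex^'n \<Rightarrow> complex^'n" where
    "\<psi> z = (\<chi> i. if i = x then z $ x * (1 / (1 - (- (z $ x * z $ y))))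
      else if i = y then z $ y * catalan_fun (z $ y) else z $ i)" for z
  obtain G :: "(complex, 'n) mfps" where G: "(1 - mfps_X x * shifted_var y) * G = 1"
    using mfps_right_inverse[of "1 - mfps_X x * shifted_var y :: (complex, 'n) mfps"]
    by (auto simp: mfps_nth_one)
  obtain F :: "(complex, 'n) mfps" where F: "(1 - (- (mfps_X x * mfps_X y))) * F = 1"
    using mfps_right_inverse[of "1 - (- (mfps_X x * mfps_X y)) :: (complex, 'n) mfps"]
    by (auto simp: mfps_nth_one)
  have F': "(\<lambda>z. 1 / (1 - (- (z $ x * z $ y)))) has_mfps_expansion F"
    by (rule convergent_mfps_inverse[OF _ _ F]) (auto intro!: has_mfps_expansion_intros)
  obtain H where H: "(\<lambda>z. catalan_fun (monom_val z (axis y 1))) has_mfps_expansion H"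
    by (rule has_mfps_expansion_catalan[of "axis y 1" y]) (auto simp: axis_def)
  have small: "\<forall>\<^sub>F z :: complex^'n in nhds 0. \<forall>i. norm (z $ i) < 1 / 4"
    by (rule eventually_small_components) simp
  have "\<psi> has_taylor (\<chi> i. if i = x then mfps_X x * F else if i = y then mfps_X y * H else mfps_X i)"
    unfolding has_taylor_def
  proof
    fix j
    show "(\<lambda>z. \<psi> z $ j) has_mfps_expansion
      ((\<chi> i. if i = x then mfps_X x * F else if i = y then mfps_X y * H else mfps_X i) $ j)"
      using has_mfps_expansion_mult[OF has_mfps_expansion_X[of x] F'] H unfolding \<psi>_def monom_val_add monom_val_axis
      by (auto intro!: has_mfps_expansion_intros)
  qed
  moreover have "\<forall>\<^sub>F z in nhds 0. \<psi> (moebius_map x y z) = z"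
    using small
  proof eventually_elim
    case (elim z)
    define t where "t = z $ x * (z $ y * (1 + z $ y))"
    have "norm t < 1 / 2" unfolding t_def using elim by (intro norm_shifted_mult_bound) auto
    then have t1: "1 - t \<noteq> 0" by auto
    have "norm (z $ y) < 1 / 2" using elim[rule_format, of y] by simp
    then have 2: "catalan_fun (z $ y * (1 + z $ y)) * (1 + z $ y) = 1" by (rule catalan_fun_inverse)
    have "z $ x / (1 - t) * (z $ y * (1 + z $ y)) = t / (1 - t)" by (simp add: t_def)
    moreover have "1 + t / (1 - t) = 1 / (1 - t)" using t1 by (simp add: field_simps)
    ultimately have "z $ x / (1 - t) / (1 + z $ x / (1 - t) * (z $ y * (1 + z $ y))) = z $ x"
      using t1 by simp
    moreover have "z $ y * (1 + z $ y) * catalan_fun (z $ y * (1 + z $ y))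
        = z $ y * (catalan_fun (z $ y * (1 + z $ y)) * (1 + z $ y))"
      by (simp add: mult_ac)
    ultimately show ?case
      using xy 2 by (simp add: vec_eq_iff \<psi>_def moebius_map_def flip: t_def)
  qed
  moreover have "\<forall>\<^sub>F z in nhds 0. moebius_map x y (\<psi> z) = z"
    using small
  proof eventually_elim
    case (elim z)
    have \<psi>y: "\<psi> z $ y = z $ y * catalan_fun (z $ y)"
      and \<psi>x: "\<psi> z $ x = z $ x * (1 / (1 - - (z $ x * z $ y)))"
      and \<psi>: "\<And>i. i \<noteq> x \<Longrightarrow> i \<noteq> y \<Longrightarrow> \<psi> z $ i = z $ i"
      using xy by (simp_all add: \<psi>_def)
    have 1: "\<psi> z $ y * (1 + \<psi> z $ y) = z $ y"
      unfolding \<psi>y mult.assoc catalan_fun_eq by simp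
    define t where "t = z $ x * z $ y"
    have "norm t \<le> 1 / 4 * (1 / 4)"
      unfolding t_def norm_mult using elim by (intro mult_mono) (auto intro: less_imp_le)
    then have t1: "1 + t \<noteq> 0" by (auto simp: add_eq_0_iff)
    have "z $ x / (1 + t) * z $ y = t / (1 + t)" by (simp add: t_def)
    moreover have "1 - t / (1 + t) = 1 / (1 + t)" using t1 by (simp add: field_simps)
    ultimately have 2: "\<psi> z $ x * (1 / (1 - \<psi> z $ x * z $ y)) = z $ x"
      using t1 by (simp add: \<psi>x flip: t_def)
    show ?case
      unfolding moebius_map_def 1 2 by (simp add: vec_eq_iff \<psi>)
  qed
  moreover have "\<psi> 0 = 0" "moebius_map x y 0 = 0"
    by (simp_all add: vec_eq_iff \<psi>_def moebius_map_def)
  ultimately show ?thesis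
    using moebius_map_has_taylor[OF G] unfolding analytic_Diff_def
    by (auto intro!: exI[of _ \<psi>])
qed

lemma Fix_shear_map:
  assumes "x \<noteq> y"
  shows "Fix (shear_map x y) = {z. z $ y = 0}"
proof -
  have "z $ y = 0" if "shear_map x y z = z" for z
    using arg_cong[OF that, of "\<lambda>z. z $ y"] assms by (simp add: shear_map_def algebra_simps)
  moreover have "shear_map x y z = z" if "z $ y = 0" for z
    using that by (simp add: shear_map_def vec_eq_iff)
  ultimately show ?thesis unfolding Fix_def by blast
qed


section \<open>Restriction to a coordinate plane\<close>

text \<open>The outer variable of the nested power series is \<open>y\<close>, the inner one is the coordinate \<open>i\<close>.\<close>

definition plane_series :: "'n \<Rightarrow> 'n \<Rightarrow> ('a::comm_ring_1, 'n::finite) mfps \<Rightarrow> 'a fps fps" where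
  "plane_series i y F = Abs_fps (\<lambda>b. Abs_fps (\<lambda>a. mfps_nth F (axis i a + axis y b)))"

lemma plane_series_nth:
  "fps_nth (fps_nth (plane_series i y F) b) a = mfps_nth F (axis i a + axis y b)"
  by (simp add: plane_series_def)

lemma axis_plus_axis_eq:
  assumes "i \<noteq> y"
  shows "axis i a + axis y b = (axis i a' + axis y b' :: nat^'n) \<longleftrightarrow> a = a' \<and> b = b'"
proof
  assume *: "axis i a + axis y b = (axis i a' + axis y b' :: nat^'n)"
  from arg_cong[OF *, of "\<lambda>m. m $ i"] arg_cong[OF *, of "\<lambda>m. m $ y"] assms
  show "a = a' \<and> b = b'" by (simp add: axis_def)
qed simp

lemma exponents_le_plane:
  assumes "i \<noteq> y" "p + q = (axis i a + axis y b :: nat^'n)"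
  obtains a1 b1 where "p = axis i a1 + axis y b1" "q = axis i (a - a1) + axis y (b - b1)" "a1 \<le> a" "b1 \<le> b"
proof
  have *: "p $ j + q $ j = (if j = i then a else if j = y then b else 0)" for j
    using arg_cong[OF assms(2), of "\<lambda>m. m $ j"] assms(1) by (auto simp: axis_def)
  have 0: "p $ j = 0 \<and> q $ j = 0" if "j \<noteq> i" "j \<noteq> y" for j
    using *[of j] that by simp
  show "p = axis i (p $ i) + axis y (p $ y)"
    using 0 assms(1) by (auto simp: vec_eq_iff axis_def)
  show "q = axis i (a - p $ i) + axis y (b - p $ y)"
    using *[of i] *[of y] 0 assms(1) by (auto simp: vec_eq_iff axis_def)
  show "p $ i \<le> a" "p $ y \<le> b" using *[of i] *[of y] assms(1) by auto
qed

text \<open>Setting the other variables to zero is a ring homomorphism: both parts of a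
  decomposition of an exponent supported on \<open>i\<close> and \<open>y\<close> are supported
  there too.\<close>

lemma plane_series_mult:
  fixes F G :: "('a::comm_ring_1, 'n::finite) mfps"
  assumes iy: "i \<noteq> y"
  shows "plane_series i y (F * G) = plane_series i y F * plane_series i y G"
proof (rule fps_ext, rule fps_ext)
  fix b a
  let ?e = "\<lambda>a b. axis i a + axis y b :: nat^'n"
  have "mfps_nth (F * G) (?e a b)
      = (\<Sum>(a1, b1)\<in>{0..a} \<times> {0..b}. mfps_nth F (?e a1 b1) * mfps_nth G (?e (a - a1) (b - b1)))"
    unfolding mfps_nth_mult
  proof (rule sum.reindex_bij_witness[where
        j = "\<lambda>(p, q). (p $ i, p $ y)" and i = "\<lambda>(a1, b1). (?e a1 b1, ?e (a - a1) (b - b1))"])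
    fix pq assume "pq \<in> {(p, q). p + q = ?e a b}"
    then obtain p q where pq: "pq = (p, q)" "p + q = ?e a b" by blast
    obtain a1 b1 where *: "p = ?e a1 b1" "q = ?e (a - a1) (b - b1)" "a1 \<le> a" "b1 \<le> b"
      using exponents_le_plane[OF iy pq(2)] by blast
    have "p $ i = a1" "p $ y = b1" using iy by (auto simp: * axis_def)
    then show "(case case pq of (p, q) \<Rightarrow> (p $ i, p $ y) of
        (a1, b1) \<Rightarrow> (?e a1 b1, ?e (a - a1) (b - b1))) = pq"
      "(case pq of (p, q) \<Rightarrow> (p $ i, p $ y)) \<in> {0..a} \<times> {0..b}"
      "(case case pq of (p, q) \<Rightarrow> (p $ i, p $ y) of
        (a1, b1) \<Rightarrow> mfps_nth F (?e a1 b1) * mfps_nth G (?e (a - a1) (b - b1)))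
        = (case pq of (p, q) \<Rightarrow> mfps_nth F p * mfps_nth G q)"
      unfolding pq(1) using *(3,4) by (simp_all add: *(1,2)[symmetric])
  next
    fix ab assume "ab \<in> {0..a} \<times> {0..b}"
    then obtain a1 b1 where ab: "ab = (a1, b1)" "a1 \<le> a" "b1 \<le> b" by auto
    then show "(case ab of (a1, b1) \<Rightarrow> (?e a1 b1, ?e (a - a1) (b - b1))) \<in> {(p, q). p + q = ?e a b}"
      by (auto simp: vec_eq_iff axis_def)
    show "(case case ab of (a1, b1) \<Rightarrow> (?e a1 b1, ?e (a - a1) (b - b1)) of (p, q) \<Rightarrow> (p $ i, p $ y)) = ab"
      using iy by (simp add: ab axis_def)
  qed
  also have "\<dots> = (\<Sum>b1 = 0..b. \<Sum>a1 = 0..a. mfps_nth F (?e a1 b1) * mfps_nth G (?e (a - a1) (b - b1)))"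
    by (subst sum.swap) (simp add: sum.cartesian_product)
  finally show "fps_nth (fps_nth (plane_series i y (F * G)) b) a
      = fps_nth (fps_nth (plane_series i y F * plane_series i y G) b) a"
    by (simp add: plane_series_nth fps_mult_nth fps_sum_nth)
qed

lemma plane_series_add: "plane_series i y (F + G) = plane_series i y F + plane_series i y G"
  by (rule fps_ext, rule fps_ext) (simp add: plane_series_nth)

lemma plane_series_diff: "plane_series i y (F - G) = plane_series i y F - plane_series i y G"
  by (rule fps_ext, rule fps_ext) (simp add: plane_series_nth)

lemma axis_plus_axis_eq_0: "axis i a + axis y b = (0 :: nat^'n) \<longleftrightarrow> a = 0 \<and> b = 0"
proof
  assume *: "axis i a + axis y b = (0 :: nat^'n)"
  from arg_cong[OF *, of "\<lambda>m. m $ i"] arg_cong[OF *, of "\<lambda>m. m $ y"]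
  show "a = 0 \<and> b = 0" by (simp add: axis_def)
qed simp

lemma plane_series_1: "plane_series i y 1 = 1"
  by (rule fps_ext, rule fps_ext) (simp add: plane_series_nth mfps_nth_one axis_plus_axis_eq_0)

lemma plane_series_sum: "plane_series i y (\<Sum>k\<in>A. F k) = (\<Sum>k\<in>A. plane_series i y (F k))"
proof (induction A rule: infinite_finite_induct)
  have "plane_series i y 0 = 0" by (rule fps_ext, rule fps_ext) (simp add: plane_series_nth)
  then show "plane_series i y (\<Sum>k\<in>{}. F k) = (\<Sum>k\<in>{}. plane_series i y (F k))"
    "infinite A \<Longrightarrow> plane_series i y (\<Sum>k\<in>A. F k) = (\<Sum>k\<in>A. plane_series i y (F k))" for A
    by simp_all
qed (simp add: plane_series_add)

section \<open>Transversal formality\<close>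

text \<open>Evaluate at the point with all coordinates \<open>r\<close>. Summability passes to the
  subfamily with y-exponent \<open>b\<close>, and the factor \<open>r ^ b\<close> can be divided
  out.\<close>

lemma convergent_mfps_plane_conv_radius:
  fixes F :: "(complex, 'n::finite) mfps"
  assumes F: "F \<in> convergent_mfps" and iy: "i \<noteq> y"
  shows "fps_conv_radius (fps_nth (plane_series i y F) b) > 0"
proof -
  obtain f where "f has_mfps_expansion F" using F by (auto simp: convergent_mfps_def)
  then obtain r where r: "r > 0" "\<And>z. (\<And>i. norm (z $ i) \<le> r) \<Longrightarrow>
      ((\<lambda>m. mfps_nth F m * monom_val z m) has_sum f z) UNIV"
    unfolding has_mfps_expansion_alt by (rule eventually_nhds_0_polydisc) blast
  define z :: "complex^'n" where "z = (\<chi> j. of_real r)"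
  let ?e = "\<lambda>a. axis i a + axis y b :: nat^'n"
  have "(\<lambda>m. mfps_nth F m * monom_val z m) summable_on UNIV"
    by (rule has_sum_imp_summable[OF r(2)]) (use r(1) in \<open>auto simp: z_def\<close>)
  then have "(\<lambda>m. mfps_nth F m * monom_val z m) summable_on range ?e"
    by (rule summable_on_subset_banach) simp
  moreover have "inj ?e" by (intro injI) (simp only: axis_plus_axis_eq[OF iy])
  ultimately have "(\<lambda>a. mfps_nth F (?e a) * monom_val z (?e a)) summable_on UNIV"
    by (simp add: summable_on_reindex o_def)
  then have "summable (\<lambda>a. mfps_nth F (?e a) * monom_val z (?e a))"
    by (rule summable_on_imp_summable)
  then have "summable (\<lambda>a. of_real r ^ b * (mfps_nth F (?e a) * of_real r ^ a))"
    by (simp add: monom_val_add monom_val_axis z_def mult_ac)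
  then have "summable (\<lambda>a. mfps_nth F (?e a) * of_real r ^ a)"
    using r(1) by (subst (asm) summable_cmult_iff) simp
  then have "conv_radius (\<lambda>a. mfps_nth F (?e a)) \<ge> norm (of_real r :: complex)"
    by (rule conv_radius_geI)
  then show ?thesis
    using r(1) by (simp add: fps_conv_radius_def plane_series_nth) (metis ereal_less(2) less_le_trans abs_of_pos)
qed

text \<open>The axis of \<open>i\<close> lies in the set where y is 0, so the restriction of
  \<open>F\<close> to it sums to zero near 0, and the identity theorem for one variable
  applies.\<close>

lemma vanishing_ideal_plane:
  fixes F :: "(complex, 'n::finite) mfps"
  assumes F: "F \<in> vanishing_ideal {z. z $ y = 0}" and iy: "i \<noteq> y"
  shows "fps_nth (plane_series i y F) 0 = 0"
proof -
  obtain f where f: "f has_mfps_expansion F" "\<forall>\<^sub>F z in nhds 0. z $ y = 0 \<longrightarrow> f z = 0"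
    using F by (auto simp: vanishing_ideal_def)
  then have "\<forall>\<^sub>F z in nhds 0. ((\<lambda>m. mfps_nth F m * monom_val z m) has_sum f z) UNIV \<and> (z $ y = 0 \<longrightarrow> f z = 0)"
    unfolding has_mfps_expansion_alt by (rule eventually_conj)
  then obtain r where r: "r > 0" "\<And>z. (\<And>i. norm (z $ i) \<le> r) \<Longrightarrow>
      ((\<lambda>m. mfps_nth F m * monom_val z m) has_sum f z) UNIV \<and> (z $ y = 0 \<longrightarrow> f z = 0)"
    by (rule eventually_nhds_0_polydisc) blast
  let ?P = "fps_nth (plane_series i y F) 0"
  have sums: "(\<lambda>a. fps_nth ?P a * t ^ a) sums 0" if t: "norm t < r" for t
  proof -
    define z where "z = (axis i t :: complex^'n)"
    have "norm (z $ j) \<le> r" for j using t r(1) by (simp add: z_def axis_def)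
    from r(2)[OF this] have "((\<lambda>m. mfps_nth F m * monom_val z m) has_sum f z) UNIV"
      and "z $ y = 0 \<longrightarrow> f z = 0" by auto
    moreover have "z $ y = 0" using iy by (simp add: z_def axis_def)
    ultimately have "((\<lambda>m. mfps_nth F m * monom_val z m) has_sum 0) UNIV" by simp
    moreover have "monom_val z m = 0" if "m \<notin> range (axis i)" for m
    proof -
      have "m \<noteq> axis i (m $ i)" using that by auto
      then obtain j where "j \<noteq> i" "m $ j \<noteq> 0" by (auto simp: vec_eq_iff axis_def split: if_splits)
      then show ?thesis unfolding monom_val_def
        by (intro prod_zero bexI[of _ j]) (auto simp: z_def axis_def)
    qed
    ultimately have "((\<lambda>m. mfps_nth F m * monom_val z m) has_sum 0) (range (axis i))"
      by (subst has_sum_cong_neutral[of UNIV "range (axis i)" _ "\<lambda>m. mfps_nth F m * monom_val z m"]) auto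
    moreover have "inj (axis i :: nat \<Rightarrow> nat^'n)" by (auto simp: inj_def axis_eq_axis)
    ultimately have "((\<lambda>a. mfps_nth F (axis i a) * t ^ a) has_sum 0) UNIV"
      by (simp add: has_sum_reindex o_def monom_val_axis z_def)
    then show ?thesis by (simp add: plane_series_nth has_sum_imp_sums)
  qed
  have "summable (\<lambda>a. fps_nth ?P a * of_real (r / 2) ^ a)"
    using r(1) by (intro sums_summable[OF sums]) simp
  then have "conv_radius (fps_nth ?P) \<ge> norm (of_real (r / 2) :: complex)"
    by (rule conv_radius_geI)
  then have "fps_conv_radius ?P > 0"
    unfolding fps_conv_radius_def using r(1) by (rule_tac less_le_trans) auto
  moreover have "\<forall>\<^sub>F t in nhds 0. eval_fps ?P t = eval_fps 0 t"
    unfolding eventually_nhds_metric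
    using r(1) sums by (intro exI[of _ r]) (auto simp: eval_fps_def sums_unique[symmetric])
  ultimately show ?thesis by (intro eval_fps_eqD) simp_all
qed

text \<open>Restricted to the plane, each factor from the ideal is divisible by y, so a product of k
  of them is divisible by \<open>y^k\<close>. Convergence is carried along because the higher powers
  are given as finite sums of products.\<close>

lemma ideal_power_vanishing:
  fixes F :: "(complex, 'n::finite) mfps"
  assumes iy: "i \<noteq> y"
  shows "F \<in> ideal_power convergent_mfps (vanishing_ideal {z. z $ y = 0}) k \<Longrightarrow>
    F \<in> convergent_mfps \<and> (\<forall>b<k. fps_nth (plane_series i y F) b = 0)"
proof (induction k arbitrary: F)
  case (Suc k)
  note IH = Suc.IH
  let ?I = "vanishing_ideal {z. z $ y = 0} :: (complex, 'n) mfps set"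
  obtain N :: nat and u v where F: "F = (\<Sum>l<N. u l * v l)"
    and uv: "\<And>l. l < N \<Longrightarrow> u l \<in> ?I \<and> v l \<in> ideal_power convergent_mfps ?I k"
    using Suc.prems by auto
  have conv: "(\<Sum>l<M. u l * v l) \<in> convergent_mfps" if "M \<le> N" for M
    using that
  proof (induction M)
    case 0
    then show ?case
      using has_mfps_expansion_diff[OF has_mfps_expansion_1 has_mfps_expansion_1]
      by (auto simp: convergent_mfps_def)
  next
    case (Suc M)
    then have "u M \<in> ?I" "v M \<in> convergent_mfps" using uv[of M] IH by auto
    then show ?case
      using Suc by (auto simp: convergent_mfps_def vanishing_ideal_def
          intro: has_mfps_expansion_add has_mfps_expansion_mult)
  qed
  have "fps_nth (plane_series i y (u l * v l)) b = 0" if "l < N" "b < Suc k" for l b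
  proof -
    have u0: "fps_nth (plane_series i y (u l)) 0 = 0"
      using uv[OF that(1)] iy by (intro vanishing_ideal_plane) auto
    have v0: "\<forall>b<k. fps_nth (plane_series i y (v l)) b = 0"
      using uv[OF that(1)] Suc.IH by blast
    show ?thesis unfolding plane_series_mult[OF iy] fps_mult_nth
    proof (rule sum.neutral, rule ballI)
      fix c assume "c \<in> {0..b}"
      then show "fps_nth (plane_series i y (u l)) c * fps_nth (plane_series i y (v l)) (b - c) = 0"
        using u0 v0 that(2) by (cases "c = 0") auto
    qed
  qed
  with conv[of N] show ?case by (simp add: F plane_series_sum fps_sum_nth)
qed simp

text \<open>All terms \<open>c k\<close> with k above \<open>b\<close> have no \<open>y^b\<close>
  part, so the \<open>y^b\<close> coefficient of the Krull limit is that of the finite sum of the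
  first \<open>b + 1\<close> terms, which is convergent. This is the only route by which transversal
  formality enters the argument.\<close>

lemma transversally_formal_conv_radius:
  fixes \<sigma> :: "(complex, 'n::finite) mfps ^ 'n"
  assumes "transversally_formal \<sigma> {z. z $ y = 0}" and iy: "i \<noteq> y"
  shows "fps_conv_radius (fps_nth (plane_series i y (\<sigma> $ j)) b) > 0"
proof -
  obtain c where c: "\<And>k. c k \<in> ideal_power convergent_mfps (vanishing_ideal {z. z $ y = 0}) k"
    and sums: "c krull_sums (\<sigma> $ j)"
    using assms(1) unfolding transversally_formal_def by blast
  note c = ideal_power_vanishing[OF iy c]
  let ?C = "\<Sum>k<Suc b. c k"
  have "?C \<in> convergent_mfps"
  proof (induction b)
    case 0
    then show ?case using c[of 0] by simp
  next
    case (Suc b)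
    then show ?case using c[of "Suc b"]
      by (auto simp: convergent_mfps_def intro: has_mfps_expansion_add)
  qed
  then have "fps_conv_radius (fps_nth (plane_series i y ?C) b) > 0"
    using iy by (rule convergent_mfps_plane_conv_radius)
  moreover have "fps_nth (plane_series i y (\<sigma> $ j)) b = fps_nth (plane_series i y ?C) b"
  proof (rule fps_ext)
    fix a
    let ?m = "axis i a + axis y b :: nat^'n"
    \<comment> \<open>The power is one more than the total degree of \<open>?m\<close>, so the
      coefficient at \<open>?m\<close> is already exact.\<close>
    have "\<forall>\<^sub>F N in sequentially. \<sigma> $ j - (\<Sum>k<N. c k) \<in> ideal_power UNIV mfps_maximal_ideal (Suc (a + b))"
      using sums unfolding krull_sums_def by blast
    then have "\<forall>\<^sub>F N in sequentially. mfps_nth (\<sigma> $ j) ?m = mfps_nth (\<Sum>k<N. c k) ?m"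
    proof eventually_elim
      case (elim N)
      then have "mfps_order_ge (Suc (a + b)) (\<sigma> $ j - (\<Sum>k<N. c k))"
        by (rule ideal_power_maximal_order)
      then show ?case by (simp add: mfps_order_ge_def)
    qed
    then obtain N where N: "N \<ge> Suc b" "mfps_nth (\<sigma> $ j) ?m = mfps_nth (\<Sum>k<N. c k) ?m"
      unfolding eventually_sequentially by (meson nat_le_linear)
    have "mfps_nth (c k) ?m = 0" if "k \<in> {..<N} - {..<Suc b}" for k
    proof -
      have "fps_nth (plane_series i y (c k)) b = 0" using c[of k] that by auto
      then show ?thesis by (metis plane_series_nth fps_zero_nth)
    qed
    then have "(\<Sum>k<N. mfps_nth (c k) ?m) = (\<Sum>k<Suc b. mfps_nth (c k) ?m)"
      using N(1) by (intro sum.mono_neutral_right) auto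
    with N(2) show "fps_nth (fps_nth (plane_series i y (\<sigma> $ j)) b) a
        = fps_nth (fps_nth (plane_series i y ?C) b) a"
      by (simp add: plane_series_nth mfps_nth_sum)
  qed
  ultimately show ?thesis by simp
qed


section \<open>The irregular singular differential equation\<close>

lemma fps_X2_deriv_nth:
  "fps_nth (fps_X\<^sup>2 * fps_deriv f) n = (if n < 2 then 0 else of_nat (n - 1) * fps_nth f (n - 1))"
proof (cases "n < 2")
  case False
  then obtain k where "n = Suc (Suc k)" by (metis add_2_eq_Suc le_Suc_ex not_less)
  then show ?thesis by (simp add: fps_X_power_mult_nth)
qed (simp add: fps_X_power_mult_nth)

text \<open>Comparison of coefficients gives \<open>h_1 = 1\<close> and
  \<open>h_(n+1) = - n h_n\<close>, so the n-th coefficient has modulus (n - 1)! whatever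
  \<open>c\<close> is.\<close>

lemma euler_equation_divergent:
  fixes h :: "complex fps"
  assumes h: "h + fps_X\<^sup>2 * fps_deriv h = fps_const c + fps_X"
  shows "fps_conv_radius h = 0"
proof -
  have nth: "fps_nth h n + fps_nth (fps_X\<^sup>2 * fps_deriv h) n = fps_nth (fps_const c + fps_X) n" for n
    using arg_cong[OF h, of "\<lambda>f. fps_nth f n"] by simp
  have h1: "fps_nth h 1 = 1" using nth[of 1] by (simp add: fps_X2_deriv_nth)
  have hSuc: "fps_nth h (Suc n) = - of_nat n * fps_nth h n" if "n \<ge> 1" for n
    using nth[of "Suc n"] that by (simp add: fps_X2_deriv_nth add_eq_0_iff)
  have nz: "fps_nth h n \<noteq> 0" if "n \<ge> 1" for n
    using that by (induction n rule: dec_induct) (use h1 hSuc in auto)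
  have "conv_radius (fps_nth h) = 0"
  proof (rule conv_radius_ratio_limit[where c = 0])
    show "\<forall>\<^sub>F n in sequentially. fps_nth h n \<noteq> 0"
      using eventually_ge_at_top[of 1] by eventually_elim (rule nz)
    have "\<forall>\<^sub>F n in sequentially. inverse (real n) = norm (fps_nth h n) / norm (fps_nth h (Suc n))"
      using eventually_ge_at_top[of 1]
      by eventually_elim (simp add: hSuc nz norm_mult divide_simps)
    then show "(\<lambda>n. norm (fps_nth h n) / norm (fps_nth h (Suc n))) \<longlonglongrightarrow> 0"
      using lim_inverse_n by (rule Lim_transform_eventually[rotated])
  qed (simp add: zero_ereal_def)
  then show ?thesis by (simp add: fps_conv_radius_def)
qed

lemma euler_equation_solvable:
  obtains h :: "complex fps" where "h + fps_X\<^sup>2 * fps_deriv h = fps_const c + fps_X"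
proof
  let ?h = "Abs_fps (\<lambda>n. if n = 0 then c else (- 1) ^ (n - 1) * fact (n - 1))"
  show "?h + fps_X\<^sup>2 * fps_deriv ?h = fps_const c + fps_X"
  proof (rule fps_ext)
    fix n
    consider "n = 0" | "n = 1" | k where "n = Suc (Suc k)" by (metis One_nat_def not0_implies_Suc)
    then show "fps_nth (?h + fps_X\<^sup>2 * fps_deriv ?h) n = fps_nth (fps_const c + fps_X) n"
      by cases (simp_all add: fps_X2_deriv_nth)
  qed
qed

text \<open>Multiplication by a unit preserves the order of a series whereas \<open>x^2 d/dx\<close>
  raises it, so a nonzero \<open>g\<close> would give a contradiction at its leading
  coefficient.\<close>

lemma fps_eq_X2_deriv_imp_zero:
  fixes g u :: "complex fps"
  assumes "u * g = fps_X\<^sup>2 * fps_deriv g" "fps_nth u 0 \<noteq> 0"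
  shows "g = 0"
proof (rule ccontr)
  assume "g \<noteq> 0"
  define n where "n = subdegree g"
  have "fps_nth (u * g) n = fps_nth u 0 * fps_nth g n"
    unfolding fps_mult_nth
    by (subst sum.cong[OF refl, where h = "\<lambda>i. if i = 0 then fps_nth u 0 * fps_nth g n else 0"])
       (auto simp: n_def intro!: nth_less_subdegree_zero)
  moreover have "fps_nth (fps_X\<^sup>2 * fps_deriv g) n = 0"
    by (cases "n < 2") (auto simp: fps_X2_deriv_nth n_def intro!: nth_less_subdegree_zero)
  moreover have "fps_nth g n \<noteq> 0" using \<open>g \<noteq> 0\<close> by (simp add: n_def)
  ultimately show False using assms by simp
qed

text \<open>With \<open>s = - 1 / s\<^sub>0\<close> the first equation says \<open>x\<^sup>2 s' = 1\<close>, and \<open>s\<^sub>1 = s\<^sub>0\<^sup>2 h\<close> turns the second one into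
  Euler's equation \<open>h + x\<^sup>2 h' = c + x\<close>.\<close>

lemma divergent_variation:
  fixes s0 s1 :: "complex fps"
  assumes s0: "fps_X\<^sup>2 * fps_deriv s0 = s0\<^sup>2" "fps_nth s0 0 = 0" "fps_nth s0 1 \<noteq> 0"
    and s1: "s1 + fps_X\<^sup>2 * fps_deriv s1 - 2 * s0 * s1 = s0\<^sup>2 * (fps_const c + fps_X)"
    and conv: "fps_conv_radius s0 > 0"
  shows "fps_conv_radius s1 = 0"
proof (rule ccontr)
  assume "fps_conv_radius s1 \<noteq> 0"
  moreover have "fps_conv_radius s1 \<ge> 0" by (simp add: fps_conv_radius_def conv_radius_nonneg)
  ultimately have conv1: "fps_conv_radius s1 > 0" by simp
  obtain h :: "complex fps" where h: "h + fps_X\<^sup>2 * fps_deriv h = fps_const c + fps_X"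
    by (rule euler_equation_solvable)
  \<comment> \<open>Variation of constants: \<open>s0\<^sup>2 * h\<close> is a particular solution,
    and the difference \<open>g\<close> solves a homogeneous equation whose only formal solution is
    0.\<close>
  define g where "g = s1 - s0\<^sup>2 * h"
  have "s0\<^sup>2 * h + fps_X\<^sup>2 * fps_deriv (s0\<^sup>2 * h) - 2 * s0 * (s0\<^sup>2 * h)
      = s0\<^sup>2 * (h + fps_X\<^sup>2 * fps_deriv h) + 2 * s0 * h * (fps_X\<^sup>2 * fps_deriv s0) - 2 * s0 * (s0\<^sup>2 * h)"
    by (simp add: fps_deriv_power algebra_simps power2_eq_square)
  also have "\<dots> = s0\<^sup>2 * (fps_const c + fps_X)"
    unfolding h s0(1) by (simp add: algebra_simps)
  finally have "g + fps_X\<^sup>2 * fps_deriv g - 2 * s0 * g = 0"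
    using s1 by (simp add: g_def algebra_simps)
  then have "(2 * s0 - 1) * g = fps_X\<^sup>2 * fps_deriv g"
    by (simp add: algebra_simps add_eq_0_iff)
  moreover have "fps_nth (2 * s0 - 1) 0 \<noteq> 0" using s0(2) by simp
  ultimately have "g = 0" by (rule fps_eq_X2_deriv_imp_zero)
  then have s1_eq: "s1 = s0\<^sup>2 * h" by (simp add: g_def)
  \<comment> \<open>\<open>s0\<close> has order exactly one, so \<open>r\<close> is a unit and
    \<open>h\<close> arises from the convergent series \<open>s1 / r^2\<close> by dividing by
    \<open>x^2\<close>.\<close>
  define r where "r = fps_shift 1 s0"
  have s0_eq: "s0 = r * fps_X"
    unfolding r_def using s0(2) by (intro fps_ext) (auto simp: fps_mult_fps_X_commute split: nat.split)
  have r0: "fps_nth r 0 \<noteq> 0" using s0(3) by (simp add: r_def)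
  have "s1 * inverse (r\<^sup>2) = (h * fps_X\<^sup>2) * (r\<^sup>2 * inverse (r\<^sup>2))"
    by (simp add: s1_eq s0_eq power_mult_distrib mult_ac)
  also have "r\<^sup>2 * inverse (r\<^sup>2) = 1" using r0 by (intro inverse_mult_eq_1') (simp add: fps_power_zeroth)
  finally have "h = fps_shift 2 (s1 * inverse (r\<^sup>2))" by simp
  moreover have "fps_conv_radius (s1 * inverse (r\<^sup>2)) > 0"
  proof -
    have "fps_conv_radius r > 0" using conv by (simp add: r_def)
    then have "fps_conv_radius (r\<^sup>2) > 0" by (rule less_le_trans[OF _ fps_conv_radius_power])
    then have "fps_conv_radius (inverse (r\<^sup>2)) > 0"
      using r0 by (intro fps_conv_radius_inverse_pos) (simp_all add: fps_power_zeroth)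
    with conv1 show ?thesis by (intro less_le_trans[OF _ fps_conv_radius_mult]) simp
  qed
  ultimately have "fps_conv_radius h > 0" by simp
  with euler_equation_divergent[OF h] show False by simp
qed


section \<open>Coefficients of a composition with the shear\<close>

text \<open>The image of \<open>f\<close> under the linear map that replaces each power
  \<open>x^a\<close> by \<open>x^a * w a\<close>, the form taken by a substitution that multiplies
  monomials by units.\<close>

definition weighted_fps :: "'a::comm_ring_1 fps \<Rightarrow> (nat \<Rightarrow> 'a fps) \<Rightarrow> 'a fps" where
  "weighted_fps f w = Abs_fps (\<lambda>n. \<Sum>a = 0..n. fps_nth f a * fps_nth (w a) (n - a))"

lemma weighted_fps_add: "weighted_fps f (\<lambda>a. v a + w a) = weighted_fps f v + weighted_fps f w"
  by (rule fps_ext) (simp add: weighted_fps_def distrib_left sum.distrib)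

lemma weighted_fps_cmult: "weighted_fps f (\<lambda>a. fps_const c * w a) = fps_const c * weighted_fps f w"
  by (rule fps_ext) (simp add: weighted_fps_def sum_distrib_left mult_ac)

lemma weighted_fps_monom:
  "weighted_fps f (\<lambda>a. fps_const (c a) * fps_X ^ k)
    = Abs_fps (\<lambda>n. if n < k then 0 else c (n - k) * fps_nth f (n - k))"
proof (rule fps_ext)
  fix n
  have "(\<Sum>a = 0..n. fps_nth f a * (c a * (if n - a = k then 1 else 0)))
      = (\<Sum>a = 0..n. if a = n - k \<and> k \<le> n then c (n - k) * fps_nth f (n - k) else 0)"
    by (intro sum.cong) auto
  then show "fps_nth (weighted_fps f (\<lambda>a. fps_const (c a) * fps_X ^ k)) n
      = fps_nth (Abs_fps (\<lambda>n. if n < k then 0 else c (n - k) * fps_nth f (n - k))) n"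
    by (auto simp: weighted_fps_def fps_X_power_nth not_less)
qed

lemma weighted_fps_1: "weighted_fps f (\<lambda>a. 1) = f"
  using weighted_fps_monom[of f "\<lambda>_. 1" 0] by (simp add: fps_eq_iff)

lemma weighted_fps_deriv:
  "weighted_fps f (\<lambda>a. fps_const (of_nat a) * fps_X) = fps_X\<^sup>2 * fps_deriv f"
  using weighted_fps_monom[of f of_nat 1] by (intro fps_ext) (auto simp: fps_X2_deriv_nth)

text \<open>Doubled in order to clear the denominator of \<open>a (a - 1) / 2\<close>; the later
  second-order formulas keep this factor.\<close>

lemma weighted_fps_deriv2:
  fixes f :: "complex fps"
  shows "2 * weighted_fps f (\<lambda>a. fps_const (of_nat (a choose 2)) * fps_X\<^sup>2)
    = fps_X ^ 4 * fps_deriv (fps_deriv f)"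
proof (rule fps_ext)
  fix n
  have choose: "2 * of_nat (k choose 2) = (of_nat k * (of_nat k - 1) :: complex)" for k :: nat
  proof -
    have "even (k * (k - 1))" by (cases k) auto
    then have "2 * (k choose 2) = k * (k - 1)" by (simp add: choose_two)
    then have "of_nat (2 * (k choose 2)) = (of_nat (k * (k - 1)) :: complex)" by (rule arg_cong)
    then show ?thesis by (cases k) (simp_all add: algebra_simps)
  qed
  show "fps_nth (2 * weighted_fps f (\<lambda>a. fps_const (of_nat (a choose 2)) * fps_X\<^sup>2)) n
      = fps_nth (fps_X ^ 4 * fps_deriv (fps_deriv f)) n"
  proof (cases "n < 4")
    case True
    then have "n < 2 \<or> n = 2 \<or> n = 3" by auto
    then show ?thesis
      by (auto simp: weighted_fps_monom fps_X_power_mult_nth numeral_fps_const)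
  next
    case False
    define k where "k = n - 4"
    have n: "n = k + 4" using False by (simp add: k_def)
    have "fps_nth (2 * weighted_fps f (\<lambda>a. fps_const (of_nat (a choose 2)) * fps_X\<^sup>2)) n
        = (2 * of_nat ((k + 2) choose 2)) * fps_nth f (k + 2)"
      by (simp add: weighted_fps_monom n numeral_fps_const)
    moreover have "fps_nth (fps_X ^ 4 * fps_deriv (fps_deriv f)) n
        = of_nat (k + 1) * (of_nat (k + 2) * fps_nth f (k + 2))"
      by (simp add: n fps_X_power_mult_nth)
    ultimately show ?thesis unfolding choose by (simp only: of_nat_add of_nat_1 of_nat_numeral) simp
  qed
qed

text \<open>The restriction of \<open>(1 + x y')\<^sup>a (1 + y)\<^sup>b\<close> to a coordinate plane, where \<open>t\<close> is the restriction of \<open>x\<close>.\<close>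

definition shear_factor :: "complex fps \<Rightarrow> nat \<Rightarrow> nat \<Rightarrow> complex fps fps" where
  "shear_factor t a b = (1 + fps_const t * (fps_X * (1 + fps_X))) ^ a * (1 + fps_X) ^ b"

lemma shear_factor_nth:
  shows "fps_nth (shear_factor t a b) 0 = 1"
    and "fps_nth (shear_factor t a b) 1 = of_nat a * t + of_nat b"
    and "fps_nth (shear_factor t a b) 2
      = of_nat a * t + of_nat (a choose 2) * t\<^sup>2 + of_nat b * (of_nat a * t) + of_nat (b choose 2)"
proof -
  have mult: "fps_nth (A * B) 0 = fps_nth A 0 * fps_nth B 0"
    "fps_nth (A * B) 1 = fps_nth A 0 * fps_nth B 1 + fps_nth A 1 * fps_nth B 0"
    "fps_nth (A * B) 2 = fps_nth A 0 * fps_nth B 2 + fps_nth A 1 * fps_nth B 1 + fps_nth A 2 * fps_nth B 0"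
    for A B :: "complex fps fps"
    by (simp_all add: fps_mult_nth numeral_2_eq_2)
  let ?A = "1 + fps_const t * (fps_X * (1 + fps_X)) :: complex fps fps"
  have A: "fps_nth ?A 0 = 1" "fps_nth ?A 1 = t" "fps_nth ?A 2 = t"
    by (simp_all add: distrib_left numeral_2_eq_2)
  have Suc2: "Suc n choose 2 = n + (n choose 2)" for n
    by (simp add: numeral_2_eq_2)
  have pA: "fps_nth (?A ^ a) 0 = 1" "fps_nth (?A ^ a) 1 = of_nat a * t"
    "fps_nth (?A ^ a) 2 = of_nat a * t + of_nat (a choose 2) * t\<^sup>2" for a
    by (induction a) (simp_all add: mult A Suc2 algebra_simps power2_eq_square)
  have pB: "fps_nth ((1 + fps_X) ^ b :: complex fps fps) 0 = 1"
    "fps_nth ((1 + fps_X) ^ b :: complex fps fps) 1 = of_nat b"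
    "fps_nth ((1 + fps_X) ^ b :: complex fps fps) 2 = of_nat (b choose 2)" for b
    by (induction b) (simp_all add: mult Suc2 algebra_simps)
  show "fps_nth (shear_factor t a b) 0 = 1"
    "fps_nth (shear_factor t a b) 1 = of_nat a * t + of_nat b"
    "fps_nth (shear_factor t a b) 2
      = of_nat a * t + of_nat (a choose 2) * t\<^sup>2 + of_nat b * (of_nat a * t) + of_nat (b choose 2)"
    unfolding shear_factor_def mult pA pB by (simp_all add: algebra_simps)
qed

section \<open>The shear in a coordinate plane\<close>

definition plane_var :: "'n \<Rightarrow> 'n \<Rightarrow> complex fps" where
  "plane_var i x = (if i = x then fps_X else 0)"

lemma plane_series_X:
  fixes i y :: "'n::finite"
  assumes "i \<noteq> y"
  shows "plane_series i y (mfps_X y :: (complex, 'n) mfps) = fps_X"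
    and "x \<noteq> y \<Longrightarrow> plane_series i y (mfps_X x :: (complex, 'n) mfps) = fps_const (plane_var i x)"
proof -
  have y: "axis i a + axis y b = (axis y 1 :: nat^'n) \<longleftrightarrow> a = 0 \<and> b = 1" for a b
    using axis_plus_axis_eq[OF assms, of a b 0 1] by simp
  show "plane_series i y (mfps_X y :: (complex, 'n) mfps) = fps_X"
    by (intro fps_ext) (auto simp: plane_series_nth mfps_X_def mfps_nth_monom y[unfolded One_nat_def] fps_X_def)
  assume "x \<noteq> y"
  have x: "axis i a + axis y b = (axis x 1 :: nat^'n) \<longleftrightarrow> i = x \<and> a = 1 \<and> b = 0" for a b
  proof (cases "i = x")
    case True
    then show ?thesis using axis_plus_axis_eq[OF assms, of a b 1 0] by simp
  next
    case False
    have "(axis i a + axis y b :: nat^'n) $ x \<noteq> axis x 1 $ x"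
      using False \<open>x \<noteq> y\<close> by (simp add: axis_def)
    then show ?thesis using False by metis
  qed
  show "plane_series i y (mfps_X x :: (complex, 'n) mfps) = fps_const (plane_var i x)"
    by (intro fps_ext)
       (auto simp: plane_series_nth mfps_X_def mfps_nth_monom x[unfolded One_nat_def] plane_var_def fps_X_def)
qed

lemma plane_series_power:
  "i \<noteq> y \<Longrightarrow> plane_series i y (F ^ k) = plane_series i y F ^ k"
  by (induction k) (simp_all add: plane_series_1 plane_series_mult)

text \<open>Monomials are only multiplied by series, so exponents outside the plane cannot
  contribute inside it. A monomial with y-exponent \<open>b1\<close> reaches \<open>y^b\<close>
  through the coefficient of order \<open>b - b1\<close> of its shear factor.\<close>

lemma plane_series_compose_shear:
  fixes F :: "(complex, 'n::finite) mfps"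
  assumes xy: "x \<noteq> y" and iy: "i \<noteq> y"
  shows "fps_nth (plane_series i y (mfps_compose F (shear_mfps x y))) b
    = (\<Sum>b1 = 0..b. weighted_fps (fps_nth (plane_series i y F) b1)
        (\<lambda>a. fps_nth (shear_factor (plane_var i x) a b1) (b - b1)))"
proof (rule fps_ext)
  fix a
  let ?e = "\<lambda>a b. axis i a + axis y b :: nat^'n"
  let ?U = "\<lambda>k :: nat^'n. (1 + mfps_X x * shifted_var y) ^ (k $ x) * (1 + mfps_X y) ^ (k $ y) :: (complex, 'n) mfps"
  have U: "plane_series i y (?U (?e a1 b1)) = shear_factor (plane_var i x) a1 b1" for a1 b1
  proof -
    have x: "?e a1 b1 $ x = (if i = x then a1 else 0)" and y: "?e a1 b1 $ y = b1"
      using xy iy by (auto simp: axis_def)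
    have "plane_series i y (?U (?e a1 b1))
        = (1 + fps_const (plane_var i x) * (fps_X * (1 + fps_X))) ^ (if i = x then a1 else 0)
          * (1 + fps_X) ^ b1"
      unfolding x y shifted_var_def plane_series_mult[OF iy] plane_series_power[OF iy]
        plane_series_add plane_series_1 plane_series_X(1)[OF iy] plane_series_X(2)[OF iy xy] ..
    moreover have "(1 + fps_const (0 :: complex fps) * (fps_X * (1 + fps_X))) ^ a1 = 1"
      unfolding fps_const_0_eq_0 mult_zero_left by (metis add_0_right power_one)
    ultimately show ?thesis by (simp only: shear_factor_def plane_var_def split: if_splits) auto
  qed
  have "fps_nth (fps_nth (plane_series i y (mfps_compose F (shear_mfps x y))) b) a
      = (\<Sum>k | exponent_degree k \<le> exponent_degree (?e a b).
          mfps_nth F k * mfps_nth (mfps_monom k * ?U k) (?e a b))"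
    by (simp add: plane_series_nth mfps_nth_compose mfps_prod_power_shear[OF xy])
  also have "\<dots> = (\<Sum>k\<in>(\<lambda>(b1, a1). ?e a1 b1) ` ({0..b} \<times> {0..a}).
          mfps_nth F k * mfps_nth (mfps_monom k * ?U k) (?e a b))"
  proof (rule sum.mono_neutral_right)
    show "finite {k :: nat^'n. exponent_degree k \<le> exponent_degree (?e a b)}"
      by (rule finite_exponent_degree_le)
    show "(\<lambda>(b1, a1). ?e a1 b1) ` ({0..b} \<times> {0..a})
        \<subseteq> {k. exponent_degree k \<le> exponent_degree (?e a b)}" by auto
    show "\<forall>k\<in>{k. exponent_degree k \<le> exponent_degree (?e a b)}
          - (\<lambda>(b1, a1). ?e a1 b1) ` ({0..b} \<times> {0..a}).
        mfps_nth F k * mfps_nth (mfps_monom k * ?U k) (?e a b) = 0"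
    proof
      fix k assume k: "k \<in> {k. exponent_degree k \<le> exponent_degree (?e a b)}
          - (\<lambda>(b1, a1). ?e a1 b1) ` ({0..b} \<times> {0..a})"
      have "\<not> (\<forall>j. k $ j \<le> ?e a b $ j)"
      proof
        assume "\<forall>j. k $ j \<le> ?e a b $ j"
        then have "k + (?e a b - k) = ?e a b" by (simp add: vec_eq_iff)
        then obtain a1 b1 where "k = ?e a1 b1" "a1 \<le> a" "b1 \<le> b"
          using exponents_le_plane[OF iy] by metis
        with k show False by auto
      qed
      then show "mfps_nth F k * mfps_nth (mfps_monom k * ?U k) (?e a b) = 0"
        by (simp only: mfps_nth_monom_mult if_False mult_zero_right)
    qed
  qed
  also have "\<dots> = (\<Sum>(b1, a1)\<in>{0..b} \<times> {0..a}.
          mfps_nth F (?e a1 b1) * mfps_nth (mfps_monom (?e a1 b1) * ?U (?e a1 b1)) (?e a b))"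
  proof (subst sum.reindex)
    show "inj_on (\<lambda>(b1, a1). ?e a1 b1) ({0..b} \<times> {0..a})"
      by (intro inj_onI) (auto simp: axis_plus_axis_eq[OF iy])
  qed (simp add: case_prod_unfold o_def)
  also have "\<dots> = (\<Sum>(b1, a1)\<in>{0..b} \<times> {0..a}. fps_nth (fps_nth (plane_series i y F) b1) a1 *
          fps_nth (fps_nth (shear_factor (plane_var i x) a1 b1) (b - b1)) (a - a1))"
  proof (intro sum.cong refl, clarify)
    fix a1 b1 assume "b1 \<in> {0..b}" "a1 \<in> {0..a}"
    then have "?e a b = ?e a1 b1 + ?e (a - a1) (b - b1)" by (simp add: vec_eq_iff axis_def)
    then have "mfps_nth (mfps_monom (?e a1 b1) * ?U (?e a1 b1)) (?e a b)
        = mfps_nth (?U (?e a1 b1)) (?e (a - a1) (b - b1))"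
      by (simp only: mfps_nth_monom_mult_add)
    also have "\<dots> = fps_nth (fps_nth (plane_series i y (?U (?e a1 b1))) (b - b1)) (a - a1)"
      by (rule plane_series_nth[symmetric])
    finally show "mfps_nth F (?e a1 b1) * mfps_nth (mfps_monom (?e a1 b1) * ?U (?e a1 b1)) (?e a b)
        = fps_nth (fps_nth (plane_series i y F) b1) a1 *
          fps_nth (fps_nth (shear_factor (plane_var i x) a1 b1) (b - b1)) (a - a1)"
      by (simp only: U plane_series_nth)
  qed
  also have "\<dots> = fps_nth (\<Sum>b1 = 0..b. weighted_fps (fps_nth (plane_series i y F) b1)
        (\<lambda>a. fps_nth (shear_factor (plane_var i x) a b1) (b - b1))) a"
    by (simp add: fps_sum_nth weighted_fps_def sum.cartesian_product)
  finally show "fps_nth (fps_nth (plane_series i y (mfps_compose F (shear_mfps x y))) b) a = \<dots>" .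
qed


lemma weighted_fps_deriv_plane_var:
  "weighted_fps f (\<lambda>a. of_nat a * plane_var i x) = (plane_var i x)\<^sup>2 * fps_deriv f"
proof (cases "i = x")
  case True
  then show ?thesis using weighted_fps_deriv[of f] by (simp add: plane_var_def fps_of_nat)
qed (simp add: plane_var_def weighted_fps_def fps_eq_iff)

lemma plane_series_compose_shear_low:
  fixes F :: "(complex, 'n::finite) mfps"
  assumes xy: "x \<noteq> y" and iy: "i \<noteq> y"
  defines "f \<equiv> fps_nth (plane_series i y F)"
    and "c \<equiv> fps_nth (plane_series i y (mfps_compose F (shear_mfps x y)))"
  shows "c 0 = f 0" and "c 1 = f 1 + (plane_var i x)\<^sup>2 * fps_deriv (f 0)"
  using weighted_fps_1[of "f 0"] weighted_fps_1[of "f 1"]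
  by (simp_all add: c_def f_def plane_series_compose_shear[OF xy iy] shear_factor_nth
        shear_factor_nth(2)[unfolded One_nat_def] weighted_fps_deriv_plane_var)

text \<open>With \<open>f 0 = 0\<close> the coefficient of \<open>y^3\<close> calls for shear
  factors of order at most two; it will be applied to the y-component of the conjugacy, which
  vanishes on the fixed set.\<close>

lemma plane_series_compose_shear_high:
  fixes F :: "(complex, 'n::finite) mfps"
  assumes xy: "x \<noteq> y"
  defines "f \<equiv> fps_nth (plane_series x y F)"
    and "c \<equiv> fps_nth (plane_series x y (mfps_compose F (shear_mfps x y)))"
  shows "2 * c 2 = 2 * f 2 + 2 * f 1 + 2 * fps_X\<^sup>2 * fps_deriv (f 1) + 2 * fps_X\<^sup>2 * fps_deriv (f 0)
      + fps_X ^ 4 * fps_deriv (fps_deriv (f 0))"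
    and "f 0 = 0 \<Longrightarrow> 2 * c 3 = 2 * f 3 + 4 * f 2 + 2 * fps_X\<^sup>2 * fps_deriv (f 2)
      + 4 * fps_X\<^sup>2 * fps_deriv (f 1) + fps_X ^ 4 * fps_deriv (fps_deriv (f 1))"
proof -
  have w0: "weighted_fps g (\<lambda>a. fps_nth (shear_factor fps_X a b) 0) = g" for g b
    by (simp add: shear_factor_nth weighted_fps_1)
  have d1: "weighted_fps g (\<lambda>a. of_nat a * fps_X) = fps_X\<^sup>2 * fps_deriv g" for g :: "complex fps"
    using weighted_fps_deriv[of g] by (simp add: fps_of_nat)
  have d2: "2 * weighted_fps g (\<lambda>a. of_nat (a choose 2) * fps_X\<^sup>2) = fps_X ^ 4 * fps_deriv (fps_deriv g)"
    for g :: "complex fps"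
    using weighted_fps_deriv2[of g] by (simp add: fps_of_nat)
  have const: "weighted_fps g (\<lambda>a. of_nat m * v a) = of_nat m * weighted_fps g v"
    for m g and v :: "nat \<Rightarrow> complex fps"
    using weighted_fps_cmult[of g "of_nat m" v] by (simp add: fps_of_nat)
  have const1: "weighted_fps g (\<lambda>a. of_nat m) = of_nat m * g" for m and g :: "complex fps"
    using const[of g m "\<lambda>_. 1"] by (simp add: weighted_fps_1)
  have w1: "weighted_fps g (\<lambda>a. fps_nth (shear_factor fps_X a b) 1)
      = fps_X\<^sup>2 * fps_deriv g + of_nat b * g" for g b
    unfolding shear_factor_nth weighted_fps_add d1 const1 ..
  have w2: "2 * weighted_fps g (\<lambda>a. fps_nth (shear_factor fps_X a b) 2)
      = 2 * (1 + of_nat b) * (fps_X\<^sup>2 * fps_deriv g) + fps_X ^ 4 * fps_deriv (fps_deriv g)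
        + 2 * of_nat (b choose 2) * g" for g b
    unfolding shear_factor_nth weighted_fps_add d1 const const1 d2[symmetric]
    by (simp add: algebra_simps)
  have pv: "plane_var x x = fps_X" by (simp add: plane_var_def)
  have c2: "c 2 = weighted_fps (f 0) (\<lambda>a. fps_nth (shear_factor fps_X a 0) 2)
      + weighted_fps (f 1) (\<lambda>a. fps_nth (shear_factor fps_X a 1) 1) + f 2"
    unfolding c_def f_def plane_series_compose_shear[OF xy xy] pv
    using w0[of "f 2" 2] by (simp add: f_def numeral_2_eq_2)
  show "2 * c 2 = 2 * f 2 + 2 * f 1 + 2 * fps_X\<^sup>2 * fps_deriv (f 1) + 2 * fps_X\<^sup>2 * fps_deriv (f 0)
      + fps_X ^ 4 * fps_deriv (fps_deriv (f 0))"
    unfolding c2 distrib_left w1 w2 by (simp add: algebra_simps)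
  assume f0: "f 0 = 0"
  have c3: "c 3 = weighted_fps (f 0) (\<lambda>a. fps_nth (shear_factor fps_X a 0) 3)
      + weighted_fps (f 1) (\<lambda>a. fps_nth (shear_factor fps_X a 1) 2)
      + weighted_fps (f 2) (\<lambda>a. fps_nth (shear_factor fps_X a 2) 1) + f 3"
    unfolding c_def f_def plane_series_compose_shear[OF xy xy] pv
    using w0[of "f 3" 3] by (simp add: f_def numeral_2_eq_2 numeral_3_eq_3)
  have "weighted_fps (f 0) v = 0" for v by (simp add: f0 weighted_fps_def fps_eq_iff)
  then show "2 * c 3 = 2 * f 3 + 4 * f 2 + 2 * fps_X\<^sup>2 * fps_deriv (f 2)
      + 4 * fps_X\<^sup>2 * fps_deriv (f 1) + fps_X ^ 4 * fps_deriv (fps_deriv (f 1))"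
    unfolding c3 distrib_left w1 w2 by (simp add: algebra_simps)
qed


section \<open>Divergence of every conjugacy\<close>

lemma fps_nth_mult_low:
  fixes A B :: "'a::comm_ring_1 fps"
  shows "fps_nth (A * B) 0 = fps_nth A 0 * fps_nth B 0"
    "fps_nth (A * B) 1 = fps_nth A 0 * fps_nth B 1 + fps_nth A 1 * fps_nth B 0"
    "fps_nth (A * B) 2 = fps_nth A 0 * fps_nth B 2 + fps_nth A 1 * fps_nth B 1 + fps_nth A 2 * fps_nth B 0"
    "fps_nth (A * B) 3 = fps_nth A 0 * fps_nth B 3 + fps_nth A 1 * fps_nth B 2
       + fps_nth A 2 * fps_nth B 1 + fps_nth A 3 * fps_nth B 0"
  by (simp_all add: fps_mult_nth numeral_2_eq_2 numeral_3_eq_3)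

lemma fps_nth_mult_one_minus:
  fixes A B K :: "'a::comm_ring_1 fps"
  assumes "A * (1 - K) = B" "fps_nth K 0 = 0"
  shows "fps_nth A 1 - fps_nth A 0 * fps_nth K 1 = fps_nth B 1"
    and "fps_nth A 2 - fps_nth A 1 * fps_nth K 1 - fps_nth A 0 * fps_nth K 2 = fps_nth B 2"
  using assms(2) unfolding assms(1)[symmetric] fps_nth_mult_low by simp_all

lemma invertible_row_nonzero:
  fixes A :: "complex^'n^'n"
  assumes "invertible A"
  shows "\<exists>i. A $ j $ i \<noteq> 0"
proof (rule ccontr)
  assume "\<not> ?thesis"
  then have A: "A $ j $ i = 0" for i by simp
  obtain B where "A ** B = mat 1" using assms by (auto simp: invertible_def)
  then have "(A ** B) $ j $ j = 1" by (simp add: mat_def)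
  then show False by (simp add: matrix_matrix_mult_def A)
qed

lemma conjugacy_not_transversally_formal:
  fixes G :: "(complex, 'n::finite) mfps"
  assumes xy: "x \<noteq> y" and G: "(1 - mfps_X x * shifted_var y) * G = 1"
    and \<sigma>: "\<sigma> \<in> formal_Diff"
    and eq: "formal_comp \<sigma> (shear_mfps x y) = formal_comp (moebius_mfps x y G) \<sigma>"
  shows "\<not> transversally_formal \<sigma> {z. z $ y = 0}"
proof
  assume transv: "transversally_formal \<sigma> {z. z $ y = 0}"
  have \<sigma>0: "\<And>j. mfps_nth (\<sigma> $ j) 0 = 0"
    and inv: "invertible (\<chi> j i. mfps_nth (\<sigma> $ j) (axis i 1) :: complex^'n^'n)"
    using \<sigma> by (auto simp: formal_Diff_def)
  define S where "S = \<sigma> $ x"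
  define V where "V = \<sigma> $ y"
  have row: "\<exists>i. mfps_nth (\<sigma> $ j) (axis i 1) \<noteq> 0" for j
    using invertible_row_nonzero[OF inv, of j] by simp
  let ?C = "\<lambda>F. mfps_compose F (shear_mfps x y)"
  have comp: "?C (\<sigma> $ j) = mfps_compose (moebius_mfps x y G $ j) \<sigma>" for j
    using arg_cong[OF eq, of "\<lambda>v. v $ j"] by (simp add: formal_comp_def)
  have sv: "mfps_compose (shifted_var y) \<sigma> = V * (1 + V)"
    by (simp add: shifted_var_def mfps_compose_mult[OF \<sigma>0] mfps_compose_add
        mfps_compose_1[OF \<sigma>0] mfps_compose_X[OF \<sigma>0] V_def)
  have CV: "?C V = V * (1 + V)"
    using comp[of y] xy sv by (simp add: V_def moebius_mfps_def)
  \<comment> \<open>The x-component of the conjugacy equation with the denominator of the second map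
    cleared.\<close>
  have CS: "?C S * (1 - S * (V * (1 + V))) = S"
  proof -
    have "?C S = mfps_compose (mfps_X x * G) \<sigma>"
      using comp[of x] by (simp add: S_def moebius_mfps_def)
    moreover have "mfps_compose (mfps_X x * G) \<sigma> * mfps_compose (1 - mfps_X x * shifted_var y) \<sigma> = S"
    proof -
      have "mfps_X x * G * (1 - mfps_X x * shifted_var y) = mfps_X x * ((1 - mfps_X x * shifted_var y) * G)"
        by (simp only: mult_ac)
      then show ?thesis
        by (simp add: G S_def mfps_compose_X[OF \<sigma>0] flip: mfps_compose_mult[OF \<sigma>0])
    qed
    ultimately show ?thesis
      by (simp add: mfps_compose_diff mfps_compose_mult[OF \<sigma>0] mfps_compose_1[OF \<sigma>0]
          mfps_compose_X[OF \<sigma>0] sv S_def)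
  qed

  \<comment> \<open>\<open>?v i b\<close> and \<open>?s i b\<close> are the coefficients of
    \<open>y^b\<close> in the plane of \<open>i\<close> and \<open>y\<close>. The plane with
    \<open>i = x\<close> carries the differential equations; the other planes control the linear
    part.\<close>
  let ?v = "\<lambda>i. fps_nth (plane_series i y V)" and ?s = "\<lambda>i. fps_nth (plane_series i y S)"
  let ?c = "\<lambda>i. fps_nth (plane_series i y (?C S))"
  have PV: "plane_series i y (?C V) = plane_series i y V * (1 + plane_series i y V)" if "i \<noteq> y" for i
    by (simp add: CV plane_series_mult[OF that] plane_series_add plane_series_1)
  \<comment> \<open>Fixed points go to fixed points: at \<open>y = 0\<close> the equation reads
    \<open>v = v + v^2\<close>.\<close>
  have v0: "?v i 0 = 0" if "i \<noteq> y" for i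
  proof -
    have "?v i 0 = ?v i 0 * (1 + ?v i 0)"
      using plane_series_compose_shear_low(1)[OF xy that, of V]
      by (simp add: PV[OF that])
    then show ?thesis by (simp add: distrib_left)
  qed
  have axis_i: "mfps_nth F (axis i 1) = fps_nth (fps_nth (plane_series i y F) 0) 1" for F i
    by (simp add: plane_series_nth)
  have axis_y: "mfps_nth F (axis y 1) = fps_nth (fps_nth (plane_series i y F) 1) 0" for F i
    by (simp add: plane_series_nth)
  \<comment> \<open>The row of \<open>V\<close> in the invertible linear part vanishes outside the
    column of \<open>y\<close>.\<close>
  have Vy: "mfps_nth V (axis y 1) \<noteq> 0"
    using row[of y] v0 axis_i[of V] by (metis V_def fps_zero_nth)
  have v1: "fps_nth (?v i 1) 0 \<noteq> 0" for i
    using Vy unfolding axis_y[of V i] .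
  let ?K = "\<lambda>i. plane_series i y S * (plane_series i y V * (1 + plane_series i y V))"
  have K: "fps_nth (?K i) 0 = 0" "fps_nth (?K i) 1 = ?s i 0 * ?v i 1"
    "fps_nth (?K i) 2 = ?s i 0 * (?v i 2 + ?v i 1 * ?v i 1) + ?s i 1 * ?v i 1" if "i \<noteq> y" for i
    by (simp_all only: fps_nth_mult_low v0[OF that] fps_add_nth fps_one_nth) simp_all
  have PS: "plane_series i y (?C S) * (1 - ?K i) = plane_series i y S" if "i \<noteq> y" for i
    using arg_cong[OF CS, of "plane_series i y"]
    by (simp add: plane_series_mult[OF that] plane_series_add plane_series_diff plane_series_1)
  \<comment> \<open>First order in y, where \<open>?s i 1\<close> cancels. For \<open>i\<close>
    other than \<open>x\<close> and \<open>y\<close> the left side is 0, which removes further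
    entries of the linear part.\<close>
  have s1: "(plane_var i x)\<^sup>2 * fps_deriv (?s i 0) = (?s i 0)\<^sup>2 * ?v i 1" if "i \<noteq> y" for i
  proof -
    have "?c i 1 - ?c i 0 * (?s i 0 * ?v i 1) = ?s i 1"
      using fps_nth_mult_one_minus(1)[OF PS[OF that] K(1)[OF that]] by (simp only: K(2)[OF that])
    then show ?thesis
      unfolding plane_series_compose_shear_low[OF xy that]
      by (simp add: algebra_simps power2_eq_square)
  qed
  have Si: "mfps_nth S (axis i 1) = 0" if "i \<noteq> x" "i \<noteq> y" for i
  proof -
    have "(?s i 0)\<^sup>2 * ?v i 1 = 0" using s1[OF that(2)] that(1) by (simp add: plane_var_def)
    moreover have "?v i 1 \<noteq> 0" using v1[of i] by auto
    ultimately have "?s i 0 = 0" by simp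
    then show ?thesis by (simp only: axis_i fps_zero_nth)
  qed

  define s0 s1 v1 v2 where "s0 = ?s x 0" and "s1 = ?s x 1" and "v1 = ?v x 1" and "v2 = ?v x 2"
  note high = plane_series_compose_shear_high[OF xy]
  \<comment> \<open>The \<open>y^2\<close> coefficient of the equation for \<open>V\<close>:
    \<open>v2\<close> cancels and \<open>v1 (v1 - 1) = x^2 v1'\<close> remains. As \<open>v1\<close>
    is a unit, this forces \<open>v1 = 1\<close>.\<close>
  have "2 * (v2 + v1 * v1) = 2 * v2 + 2 * v1 + 2 * fps_X\<^sup>2 * fps_deriv v1"
    using high(1)[of V] by (simp add: PV[OF xy] fps_nth_mult_low v0[OF xy] v1_def v2_def)
  then have "2 * (v1 * (v1 - 1) - fps_X\<^sup>2 * fps_deriv (v1 - 1)) = 0"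
    by (simp add: algebra_simps)
  then have "v1 * (v1 - 1) = fps_X\<^sup>2 * fps_deriv (v1 - 1)" by simp
  then have "v1 - 1 = 0"
    using \<open>\<And>i. fps_nth (?v i 1) 0 \<noteq> 0\<close>[of x] unfolding v1_def by (rule fps_eq_X2_deriv_imp_zero)
  then have v1_eq: "v1 = 1" by simp
  \<comment> \<open>The \<open>y^3\<close> coefficient leaves only \<open>x^2 v2' = 0\<close>. The
    free constant \<open>v2\<close> becomes the c of Euler's equation.\<close>
  have "2 * (?v x 3 + v2 * v1 + v1 * v2) = 2 * ?v x 3 + 4 * v2 + 2 * fps_X\<^sup>2 * fps_deriv v2
      + 4 * fps_X\<^sup>2 * fps_deriv v1 + fps_X ^ 4 * fps_deriv (fps_deriv v1)"
    using high(2)[OF v0[OF xy]]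
    by (simp add: PV[OF xy] fps_nth_mult_low v0[OF xy] v1_def v2_def algebra_simps)
  then have "fps_deriv v2 = 0" by (simp add: v1_eq algebra_simps)
  then obtain \<nu> where v2_eq: "v2 = fps_const \<nu>" by (metis fps_deriv_eq_0_iff)
  have s0_eq: "fps_X\<^sup>2 * fps_deriv s0 = s0\<^sup>2"
    using s1[OF xy] v1_eq by (simp add: s0_def v1_def plane_var_def)
  \<comment> \<open>Differentiating the equation for \<open>s0\<close> eliminates its second
    derivative; the term \<open>2 * fps_X * s0\<^sup>2\<close> is the source of the x in Euler's
    equation.\<close>
  have s0_deriv2: "fps_X ^ 4 * fps_deriv (fps_deriv s0) = 2 * s0 * s0\<^sup>2 - 2 * fps_X * s0\<^sup>2"
  proof -
    have "fps_deriv (fps_X\<^sup>2 * fps_deriv s0) = fps_deriv (s0\<^sup>2)" by (simp only: s0_eq)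
    then have "2 * fps_X * fps_deriv s0 + fps_X\<^sup>2 * fps_deriv (fps_deriv s0) = 2 * s0 * fps_deriv s0"
      by (simp add: fps_deriv_power power2_eq_square algebra_simps)
    then have "fps_X\<^sup>2 * fps_deriv (fps_deriv s0) = 2 * s0 * fps_deriv s0 - 2 * fps_X * fps_deriv s0"
      by (simp only: eq_diff_eq add.commute)
    then have "fps_X\<^sup>2 * (fps_X\<^sup>2 * fps_deriv (fps_deriv s0))
        = fps_X\<^sup>2 * (2 * s0 * fps_deriv s0 - 2 * fps_X * fps_deriv s0)"
      by simp
    also have "\<dots> = 2 * s0 * (fps_X\<^sup>2 * fps_deriv s0) - 2 * fps_X * (fps_X\<^sup>2 * fps_deriv s0)"
      by (simp add: algebra_simps)
    finally have "fps_X\<^sup>2 * (fps_X\<^sup>2 * fps_deriv (fps_deriv s0)) = 2 * s0 * s0\<^sup>2 - 2 * fps_X * s0\<^sup>2"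
      unfolding s0_eq .
    then show ?thesis by (simp add: power4_eq_xxxx power2_eq_square mult.assoc)
  qed
  \<comment> \<open>Second order in y of the equation for \<open>S\<close>: \<open>?s x 2\<close>
    cancels, and a linear equation for \<open>s1\<close> with coefficients in \<open>s0\<close>
    remains.\<close>
  have "?c x 2 - ?c x 1 * (s0 * v1) - ?c x 0 * (s0 * (v2 + v1 * v1) + s1 * v1) = ?s x 2"
    using fps_nth_mult_one_minus(2)[OF PS[OF xy] K(1)[OF xy]]
    by (simp only: K(2,3)[OF xy] s0_def s1_def v1_def v2_def)
  then have "?c x 2 - ?c x 1 * s0 - ?c x 0 * (s0 * (v2 + 1) + s1) = ?s x 2"
    by (simp add: v1_eq)
  moreover have "?c x 0 = s0" "?c x 1 = s1 + s0\<^sup>2"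
    using plane_series_compose_shear_low[OF xy xy, of S] s0_eq
    by (simp_all add: s0_def s1_def plane_var_def)
  moreover have "2 * ?c x 2 = 2 * ?s x 2 + 2 * s1 + 2 * fps_X\<^sup>2 * fps_deriv s1 + 2 * s0\<^sup>2
      + (2 * s0 * s0\<^sup>2 - 2 * fps_X * s0\<^sup>2)"
    using high(1)[of S] s0_eq s0_deriv2 by (simp add: s0_def s1_def mult.assoc)
  ultimately have "2 * (s1 + fps_X\<^sup>2 * fps_deriv s1 - 2 * s0 * s1 - s0\<^sup>2 * (v2 + fps_X)) = 0"
    by (simp add: algebra_simps power2_eq_square)
  then have s1_eq: "s1 + fps_X\<^sup>2 * fps_deriv s1 - 2 * s0 * s1 = s0\<^sup>2 * (fps_const \<nu> + fps_X)"
    unfolding v2_eq mult_eq_0_iff by simp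
  have s00: "fps_nth s0 0 = 0" using \<sigma>0[of x] by (simp add: s0_def S_def plane_series_nth)
  \<comment> \<open>The row of \<open>S\<close> in the linear part now vanishes outside the column
    of \<open>x\<close>, so its entry there is nonzero and \<open>s0\<close> has order exactly
    one.\<close>
  have "fps_nth s1 0 = 0"
    using arg_cong[OF s1_eq, of "\<lambda>f. fps_nth f 0"] s00 by (simp add: power2_eq_square)
  then have "mfps_nth S (axis y 1) = 0" by (simp only: axis_y[of S x] s1_def)
  then have "mfps_nth S (axis x 1) \<noteq> 0" using row[of x] Si by (metis S_def)
  then have s01: "fps_nth s0 1 \<noteq> 0" unfolding axis_i s0_def .
  have conv: "fps_conv_radius (?s x b) > 0" for b
    unfolding S_def using transv xy by (rule transversally_formal_conv_radius)
  have "fps_conv_radius s1 = 0"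
    using divergent_variation[OF s0_eq s00 s01 s1_eq] conv[of 0] by (simp add: s0_def)
  with conv[of 1] show False by (simp add: s1_def)
qed

theorem mainTheorem1:
  assumes "CARD('n::finite) \<ge> 2"
  shows "\<exists>(\<phi>\<^sub>1 :: complex^'n \<Rightarrow> complex^'n) (\<phi>\<^sub>2 :: complex^'n \<Rightarrow> complex^'n) \<Phi>\<^sub>1 \<Phi>\<^sub>2.
    \<phi>\<^sub>1 \<in> analytic_Diff \<and> \<phi>\<^sub>2 \<in> analytic_Diff \<and>
    \<phi>\<^sub>1 has_taylor \<Phi>\<^sub>1 \<and> \<phi>\<^sub>2 has_taylor \<Phi>\<^sub>2 \<and>
    (\<exists>\<sigma>\<in>formal_Diff. formal_comp \<sigma> \<Phi>\<^sub>1 = formal_comp \<Phi>\<^sub>2 \<sigma>) \<and>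
    \<not> (\<exists>\<sigma>\<in>formal_Diff. formal_comp \<sigma> \<Phi>\<^sub>1 = formal_comp \<Phi>\<^sub>2 \<sigma> \<and>
         transversally_formal \<sigma> (Fix \<phi>\<^sub>1))"
proof -
  obtain x y :: 'n where xy: "x \<noteq> y"
    using assms by (metis One_nat_def card_le_Suc0_iff_eq finite not_less_eq_eq numeral_2_eq_2 UNIV_I)
  obtain G :: "(complex, 'n) mfps" where G: "(1 - mfps_X x * shifted_var y) * G = 1"
    using mfps_right_inverse[of "1 - mfps_X x * shifted_var y :: (complex, 'n) mfps"]
    by (auto simp: mfps_nth_one)
  show ?thesis
  proof (intro exI conjI)
    show "shear_map x y \<in> analytic_Diff" by (rule shear_map_analytic_Diff[OF xy])
    show "moebius_map x y \<in> analytic_Diff" by (rule moebius_map_analytic_Diff[OF xy])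
    show "shear_map x y has_taylor shear_mfps x y" by (rule shear_map_has_taylor)
    show "moebius_map x y has_taylor moebius_mfps x y G" by (rule moebius_map_has_taylor[OF G])
    show "\<exists>\<sigma>\<in>formal_Diff. formal_comp \<sigma> (shear_mfps x y) = formal_comp (moebius_mfps x y G) \<sigma>"
      by (rule exists_formal_conjugacy[OF xy G])
    show "\<not> (\<exists>\<sigma>\<in>formal_Diff. formal_comp \<sigma> (shear_mfps x y) = formal_comp (moebius_mfps x y G) \<sigma> \<and>
         transversally_formal \<sigma> (Fix (shear_map x y)))"
      unfolding Fix_shear_map[OF xy] using conjugacy_not_transversally_formal[OF xy G] by blast
  qed
qed


end
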